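(* There is a universal Turing machine $U'$ and an $\varepsilon>0$ such that any $\varepsilon$-optimal policy for AIXI is $\Sigma^0_1$-hard; that is, with $\xi'$ the Bayesian mixture associated with $U'$, for every deterministic policy $\pi$ with $V^*_{\xi'}(\ae_{<t})-V^\pi_{\xi'}(\ae_{<t})<\varepsilon$ for all histories $\ae_{<t}$, the set $\{(h,a):\pi(h)=a\}$ is $\Sigma^0_1$-hard.
   Context: The action set is $\mathcal{A}=\{\alpha,\beta\}$, and the percept set is $\mathcal{E}=\{0,1\}\times\{0,1\}$, a percept $e=(o,r)$ consisting of a binary observation $o$ and a binary reward $r$. A history is $\ae_{<t}=a_1e_1\ldots a_{t-1}e_{t-1}\in(\mathcal{A}\times\mathcal{E})^*$. Policies are deterministic maps from histories to actions, identified with their graphs, encoded computably as sets of natural numbers. A set $A\subseteq\mathbb{N}$ is $\Sigma^0_1$-hard if every $\Sigma^0_1$ set is many-one reducible to $A$. A chronological contextual semimeasure $\nu$ assigns to all equal-length $e_{1:t}\in\mathcal{E}^t$, $a_{1:t}\in\mathcal{A}^t$ a number $\nu(e_{1:t}\,\|\,a_{1:t})\in[0,1]$ with $\nu(\epsilon\,\|\,\epsilon)\le1$ and $\sum_{e_t\in\mathcal{E}}\nu(e_{1:t}\,\|\,a_{1:t})\le\nu(e_{<t}\,\|\,a_{<t})$. A (chronological) monotone machine $T$ takes a binary program $p$ and an action sequence on a separate input tape and outputs percepts on a one-way output tape, the first $t$ percepts depending only on $p$ and $a_{1:t}$. $U$ is universal if it can simulate every such machine $T$: there is a binary string $q_T$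 with $U(q_Tp,a)=T(p,a)$ for all $p,a$. The associated mixture is $\xi_U(e_{<t}\,\|\,a_{<t}):=\sum_{p:\,e_{<t}\sqsubseteq U(p,a_{<t})}2^{-|p|}$, where $\sqsubseteq$ means ``is a prefix of'' and, as usual for monotone machines, the sum is over the minimal such programs $p$. Equivalently, it is a mixture $\sum_\nu w(\nu)\nu$ over all lower semicomputable chronological contextual semimeasures with a lower semicomputable prior $w$, $w(\nu)>0$ for all $\nu$, $\sum_\nu w(\nu)\le1$. The discount function $\gamma:\mathbb{N}\to\mathbb{R}_{\ge0}$ is computable and summable with $\Gamma_t:=\sum_{k\ge t}\gamma_k>0$ for all $t$. The value of $\pi$ in $\nu$ is $$V^\pi_\nu(\ae_{<t})=\frac1{\Gamma_t}\sum_{k=t}^\infty\gamma_k\sum_{e_{t:k}}r_k\,\frac{\nu(e_{1:k}\,\|\,a_{1:k})}{\nu(e_{<t}\,\|\,a_{<t})},\qquad a_i:=\pi(\ae_{<i})\text{ for }i\ge t,$$ and $V^*_\nu:=\sup_\pi V^\pi_\nu$. *)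

theory Defs
  imports "HOL-Analysis.Analysis" "HOL-Library.Nat_Bijection" "HOL-Library.Sublist"
begin

section \<open>Computability\<close>

text \<open>
  Partial recursive functions in unary form: a function of several arguments is a function of
  the \<^const>\<open>prod_encode\<close> of its arguments. \<^const>\<open>None\<close> means ``undefined''.
\<close>

inductive partrec :: "(nat \<Rightarrow> nat option) \<Rightarrow> bool" where
  zero: "partrec (\<lambda>n. Some 0)"
| succ: "partrec (\<lambda>n. Some (Suc n))"
| left: "partrec (\<lambda>n. Some (fst (prod_decode n)))"
| right: "partrec (\<lambda>n. Some (snd (prod_decode n)))"
| pair: "partrec f \<Longrightarrow> partrec g \<Longrightarrow>
    partrec (\<lambda>n. Option.bind (f n) (\<lambda>x. Option.bind (g n) (\<lambda>y. Some (prod_encode (x, y)))))"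
| comp: "partrec f \<Longrightarrow> partrec g \<Longrightarrow> partrec (\<lambda>n. Option.bind (g n) f)"
| prim: "partrec f \<Longrightarrow> partrec g \<Longrightarrow>
    partrec (\<lambda>n. case prod_decode n of (x, k) \<Rightarrow>
      rec_nat (f x) (\<lambda>i r. Option.bind r (\<lambda>y. g (prod_encode (x, prod_encode (i, y))))) k)"
| mu: "partrec f \<Longrightarrow>
    partrec (\<lambda>x.
      if \<exists>k. f (prod_encode (x, k)) = Some 0 \<and> (\<forall>i<k. \<exists>v>0. f (prod_encode (x, i)) = Some v)
      then Some (LEAST k. f (prod_encode (x, k)) = Some 0)
      else None)"

definition recursive :: "(nat \<Rightarrow> nat) \<Rightarrow> bool" where
  "recursive f \<longleftrightarrow> partrec (\<lambda>n. Some (f n))"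

definition recursive2 :: "(nat \<Rightarrow> nat \<Rightarrow> nat) \<Rightarrow> bool" where
  "recursive2 f \<longleftrightarrow> recursive (\<lambda>n. case prod_decode n of (x, y) \<Rightarrow> f x y)"

definition Sigma01 :: "nat set \<Rightarrow> bool" where
  "Sigma01 A \<longleftrightarrow> (\<exists>R. recursive2 R \<and> (\<forall>n. n \<in> A \<longleftrightarrow> (\<exists>m. R n m = 0)))"

definition many_one_reducible :: "nat set \<Rightarrow> nat set \<Rightarrow> bool" where
  "many_one_reducible A B \<longleftrightarrow> (\<exists>f. recursive f \<and> (\<forall>n. n \<in> A \<longleftrightarrow> f n \<in> B))"

definition Sigma01_hard :: "nat set \<Rightarrow> bool" where
  "Sigma01_hard B \<longleftrightarrow> (\<forall>A. Sigma01 A \<longrightarrow> many_one_reducible A B)"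

text \<open>
  A sequence of reals is computable if some algorithm, given \<open>k\<close> and \<open>n\<close>, returns a dyadic
  rational (its numerator given as a difference of naturals) within \<open>2\<^sup>-\<^sup>n\<close> of \<open>x k\<close>.
\<close>

definition computable_real_seq :: "(nat \<Rightarrow> real) \<Rightarrow> bool" where
  "computable_real_seq x \<longleftrightarrow> (\<exists>p q. recursive2 p \<and> recursive2 q \<and>
     (\<forall>k n. \<bar>x k - (real (p k n) - real (q k n)) / 2 ^ n\<bar> \<le> 1 / 2 ^ n))"


section \<open>Actions, percepts, histories and policies\<close>

datatype action = Alpha | Beta

text \<open>A percept is a pair of an observation bit and a reward bit.\<close>

type_synonym percept = "bool \<times> bool"
type_synonym history = "(action \<times> percept) list"
type_synonym policy = "history \<Rightarrow> action"

definition reward :: "percept \<Rightarrow> real" where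
  "reward e = of_bool (snd e)"

fun action_encode :: "action \<Rightarrow> nat" where
  "action_encode Alpha = 0"
| "action_encode Beta = 1"

fun percept_encode :: "percept \<Rightarrow> nat" where
  "percept_encode (obs, rew) = 2 * of_bool obs + of_bool rew"

definition history_encode :: "history \<Rightarrow> nat" where
  "history_encode h =
     list_encode (map (\<lambda>(a, e). prod_encode (action_encode a, percept_encode e)) h)"

definition policy_graph :: "policy \<Rightarrow> nat set" where
  "policy_graph \<pi> = {prod_encode (history_encode h, action_encode a) | h a. \<pi> h = a}"


section \<open>Chronological monotone machines\<close>

text \<open>
  A machine has a one-way read-only program tape, a one-way read-only action tape and a one-way
  write-only output tape. Its control state together with the contents of its work tapes is
  represented by a single natural number, initially \<open>0\<close>, on which the transition function acts
  recursively. In each step the machine computes internally, reads one symbol from one of the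
  two input tapes, or writes one percept; the second argument of \<open>next_state\<close> is the symbol
  read in this step, and is \<open>0\<close> if nothing was read.
\<close>

datatype instr = Compute | Read_Program | Read_Action | Write percept

fun instr_encode :: "instr \<Rightarrow> nat" where
  "instr_encode Compute = 0"
| "instr_encode Read_Program = 1"
| "instr_encode Read_Action = 2"
| "instr_encode (Write e) = 3 + percept_encode e"

record machine =
  instr_at :: "nat \<Rightarrow> instr"
  next_state :: "nat \<Rightarrow> nat \<Rightarrow> nat"

definition effective :: "machine \<Rightarrow> bool" where
  "effective T \<longleftrightarrow> recursive (\<lambda>s. instr_encode (instr_at T s)) \<and> recursive2 (next_state T)"

text \<open>
  A configuration consists of the state, the unread part of the program, the unread part of the
  action sequence, and the output so far. A machine that tries to read beyond the end of an
  input tape waits forever.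
\<close>

type_synonym config = "nat \<times> bool list \<times> action list \<times> percept list"

fun step :: "machine \<Rightarrow> config \<Rightarrow> config" where
  "step T (s, p, a, out) =
    (case instr_at T s of
       Compute \<Rightarrow> (next_state T s 0, p, a, out)
     | Read_Program \<Rightarrow>
         (case p of
            [] \<Rightarrow> (s, p, a, out)
          | b # p' \<Rightarrow> (next_state T s (of_bool b), p', a, out))
     | Read_Action \<Rightarrow>
         (case a of
            [] \<Rightarrow> (s, p, a, out)
          | x # a' \<Rightarrow> (next_state T s (action_encode x), p, a', out))
     | Write e \<Rightarrow> (next_state T s 0, p, a, out @ [e]))"

definition output_after :: "machine \<Rightarrow> nat \<Rightarrow> bool list \<Rightarrow> action list \<Rightarrow> percept list" where
  "output_after T n p a = (case (step T ^^ n) (0, p, a, []) of (_, _, _, out) \<Rightarrow> out)"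

text \<open>
  The output \<open>T(p, a)\<close> is a finite or infinite sequence. It is represented by the set of its
  finite prefixes, so \<open>e \<in> machine_output T p a\<close> stands for \<open>e \<sqsubseteq> T(p, a)\<close>.
\<close>

definition machine_output :: "machine \<Rightarrow> bool list \<Rightarrow> action list \<Rightarrow> percept list set" where
  "machine_output T p a = {e. \<exists>n. prefix e (output_after T n p a)}"

text \<open>The first \<open>t\<close> percepts depend only on the program and the first \<open>t\<close> actions.\<close>

definition chronological :: "machine \<Rightarrow> bool" where
  "chronological T \<longleftrightarrow> (\<forall>p a t e. t \<le> length a \<longrightarrow> length e \<le> t \<longrightarrow>
     (e \<in> machine_output T p a \<longleftrightarrow> e \<in> machine_output T p (take t a)))"

definition chronological_monotone_machine :: "machine \<Rightarrow> bool" where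
  "chronological_monotone_machine T \<longleftrightarrow> effective T \<and> chronological T"

definition universal :: "machine \<Rightarrow> bool" where
  "universal U \<longleftrightarrow> chronological_monotone_machine U \<and>
     (\<forall>T. chronological_monotone_machine T \<longrightarrow>
        (\<exists>q. \<forall>p a. machine_output U (q @ p) a = machine_output T p a))"


section \<open>Bayesian mixture and value\<close>

definition minimal_programs :: "machine \<Rightarrow> percept list \<Rightarrow> action list \<Rightarrow> bool list set" where
  "minimal_programs U e a =
     {p. e \<in> machine_output U p a \<and> (\<forall>p'. strict_prefix p' p \<longrightarrow> e \<notin> machine_output U p' a)}"

text \<open>Percepts come first: \<open>mixture U e a\<close> is \<open>\<xi>\<^sub>U(e \<parallel> a)\<close>.\<close>

definition mixture :: "machine \<Rightarrow> percept list \<Rightarrow> action list \<Rightarrow> real" where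
  "mixture U e a = (\<Sum>\<^sub>\<infinity>p\<in>minimal_programs U e a. (1/2) ^ length p)"

definition discount_tail :: "(nat \<Rightarrow> real) \<Rightarrow> nat \<Rightarrow> real" where
  "discount_tail \<gamma> t = (\<Sum>j. \<gamma> (t + j))"

definition discount_function :: "(nat \<Rightarrow> real) \<Rightarrow> bool" where
  "discount_function \<gamma> \<longleftrightarrow> (\<forall>k. 0 \<le> \<gamma> k) \<and> computable_real_seq \<gamma> \<and> summable \<gamma> \<and>
     (\<forall>t. 0 < discount_tail \<gamma> t)"

text \<open>\<open>extend \<pi> h es\<close> continues \<open>h\<close> with the percepts \<open>es\<close> and the actions chosen by \<open>\<pi>\<close>.\<close>

fun extend :: "policy \<Rightarrow> history \<Rightarrow> percept list \<Rightarrow> history" where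
  "extend \<pi> h [] = h"
| "extend \<pi> h (e # es) = extend \<pi> (h @ [(\<pi> h, e)]) es"

definition on_history :: "(percept list \<Rightarrow> action list \<Rightarrow> real) \<Rightarrow> history \<Rightarrow> real" where
  "on_history \<nu> h = \<nu> (map snd h) (map fst h)"

text \<open>
  Time starts at \<open>1\<close>, so the history \<open>h\<close> of length \<open>t - 1\<close> is the one at time \<open>t\<close>. The summation
  index \<open>k \<ge> t\<close> is written as \<open>k = t + j\<close>, and \<open>es\<close> ranges over the possible \<open>e\<^sub>t \<dots> e\<^sub>k\<close>.
\<close>

definition policy_value ::
  "(nat \<Rightarrow> real) \<Rightarrow> (percept list \<Rightarrow> action list \<Rightarrow> real) \<Rightarrow> policy \<Rightarrow> history \<Rightarrow> real" where
  "policy_value \<gamma> \<nu> \<pi> h =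
     (let t = Suc (length h) in
      1 / discount_tail \<gamma> t *
      (\<Sum>j. \<gamma> (t + j) *
         (\<Sum>es | length es = Suc j.
            reward (last es) * (on_history \<nu> (extend \<pi> h es) / on_history \<nu> h))))"

definition optimal_value ::
  "(nat \<Rightarrow> real) \<Rightarrow> (percept list \<Rightarrow> action list \<Rightarrow> real) \<Rightarrow> history \<Rightarrow> real" where
  "optimal_value \<gamma> \<nu> h = (SUP \<pi>. policy_value \<gamma> \<nu> \<pi> h)"

definition eps_optimal ::
  "(nat \<Rightarrow> real) \<Rightarrow> (percept list \<Rightarrow> action list \<Rightarrow> real) \<Rightarrow> real \<Rightarrow> policy \<Rightarrow> bool" where
  "eps_optimal \<gamma> \<nu> \<epsilon> \<pi> \<longleftrightarrow> (\<forall>h. optimal_value \<gamma> \<nu> h - policy_value \<gamma> \<nu> \<pi> h < \<epsilon>)"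

end

theory Submission
  imports Defs
begin

text \<open>
  The universal machine gives half of its weight to one environment: after the actions
  \<open>Alpha\<^sup>s Beta\<close>, the action \<open>Alpha\<close> buys a fair coin flip between reward \<open>1\<close> forever and no
  further output, while \<open>Beta\<close> starts the computation numbered \<open>s\<close> and yields reward \<open>1\<close> forever
  once it halts. All other programs that produce output start with four ones, so by Kraft's
  inequality they shift weights by at most \<open>1/16\<close>. At the query history of \<open>s\<close> the action \<open>Beta\<close> is
  therefore worth at least \<open>8/9\<close> against at most \<open>5/8\<close> for \<open>Alpha\<close> if \<open>s\<close> halts, and at most
  \<open>1/8\<close> against at least \<open>4/9\<close> otherwise, so a \<open>1/4\<close>-optimal policy decides the halting problem.
  The partial recursive functions are run by an abstract machine with an explicit stack, whose
  single steps are total recursive and serve as internal steps of the universal machine.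
\<close>

section \<open>Closure properties of recursive functions\<close>

text \<open>The value is a discounted average of the expected rewards of the single future steps, so
  every branch after the query pays either in all later steps or in none. Bounds on the single
  expected rewards then carry over to the value, and the same \<open>1/4\<close> serves for every
  discount function. This is also why the intermediate payoff of \<open>Alpha\<close> comes from one
  coin flip: alternating rewards would have a value that depends on \<gamma>. An intermediate payoff
  is needed because a worthless \<open>Alpha\<close> would allow always choosing
  \<open>Beta\<close>, and a fully rewarded one always choosing \<open>Alpha\<close>. The
  computation started by \<open>Beta\<close> takes no interaction time: internal steps are not time
  steps, so however long it runs, the very next percept carries a reward.

  The mixture is determined by the programs of the machine, so the environment has to be a branch of
  the universal machine itself, selected by a single bit. This machine must be chronological
  although the code that it simulates is arbitrary; chronology has to be enforced in a way that
  chronological machines cannot notice.\<close>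

abbreviation (input) pr :: "nat \<Rightarrow> nat \<Rightarrow> nat" where "pr x y \<equiv> prod_encode (x, y)"
abbreviation (input) pfst :: "nat \<Rightarrow> nat" where "pfst n \<equiv> fst (prod_decode n)"
abbreviation (input) psnd :: "nat \<Rightarrow> nat" where "psnd n \<equiv> snd (prod_decode n)"

lemma recursive_comp: "recursive f \<Longrightarrow> recursive g \<Longrightarrow> recursive (\<lambda>n. f (g n))"
  unfolding recursive_def by (drule (1) partrec.comp) simp

lemma recursive_Suc: "recursive f \<Longrightarrow> recursive (\<lambda>n. Suc (f n))"
  unfolding recursive_def by (drule partrec.comp[OF partrec.succ]) simp

lemma recursive_p1: "recursive f \<Longrightarrow> recursive (\<lambda>n. pfst (f n))"
  unfolding recursive_def by (drule partrec.comp[OF partrec.left]) simp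

lemma recursive_p2: "recursive f \<Longrightarrow> recursive (\<lambda>n. psnd (f n))"
  unfolding recursive_def by (drule partrec.comp[OF partrec.right]) simp

lemma recursive_pr: "recursive f \<Longrightarrow> recursive g \<Longrightarrow> recursive (\<lambda>n. pr (f n) (g n))"
  unfolding recursive_def by (drule (1) partrec.pair) simp

lemma recursive_const: "recursive (\<lambda>n. c)"
proof (induction c)
  case 0
  show ?case unfolding recursive_def by (rule partrec.zero)
qed (rule recursive_Suc)

lemma recursive_id: "recursive (\<lambda>n. n)"
  using partrec.pair[OF partrec.left partrec.right] by (simp add: recursive_def)

text \<open>The parameter of \<open>partrec.prim\<close> is instantiated with \<open>n\<close>
  itself, so base, step and number of rounds may all depend on it.\<close>

lemma recursive_rec_nat:
  assumes "recursive f" "recursive (\<lambda>n. g (pfst n) (pfst (psnd n)) (psnd (psnd n)))" "recursive k"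
  shows "recursive (\<lambda>n. rec_nat (f n) (g n) (k n))"
proof -
  let ?g = "\<lambda>n. g (pfst n) (pfst (psnd n)) (psnd (psnd n))"
  have rec: "rec_nat (Some (f x)) (\<lambda>i r. Option.bind r (\<lambda>y. Some (?g (pr x (pr i y))))) m
      = Some (rec_nat (f x) (g x) m)" for x m
    by (induction m) auto
  have "recursive (\<lambda>n. rec_nat (f (pfst n)) (g (pfst n)) (psnd n))"
    using partrec.prim[OF assms(1)[unfolded recursive_def] assms(2)[unfolded recursive_def]]
    unfolding recursive_def rec by (simp add: case_prod_beta)
  from recursive_comp[OF this recursive_pr[OF recursive_id assms(3)]] show ?thesis
    by simp
qed

lemma recursive_pred: "recursive f \<Longrightarrow> recursive (\<lambda>n. f n - 1)"
proof -
  have "rec_nat 0 (\<lambda>i r. i) m = m - 1" for m :: nat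
    by (cases m) auto
  then show "recursive f \<Longrightarrow> recursive (\<lambda>n. f n - 1)"
    using recursive_rec_nat[of "\<lambda>_. 0" "\<lambda>_ i _. i" f]
    by (simp add: recursive_p1 recursive_p2 recursive_id recursive_const)
qed

text \<open>Equality with \<open>k\<close> is reduced to zero tests of iterated predecessors.
  Comparison with constants suffices because the machines below branch on numerical tags.\<close>

lemma recursive_if_eq:
  assumes "recursive f" "recursive g" "recursive h"
  shows "recursive (\<lambda>n. if f n = k then g n else h n)"
  using assms(1)
proof (induction k arbitrary: f)
  have if0: "recursive (\<lambda>n. if f n = 0 then g n else h n)"
    if "recursive f" "recursive g" "recursive h" for f g h
  proof -
    have "rec_nat a (\<lambda>i r. b) m = (if m = 0 then a else b)" for a b m :: nat
      by (cases m) auto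
    then show ?thesis
      using recursive_rec_nat[of g "\<lambda>n _ _. h n" f] that
      by (simp add: recursive_comp[of h] recursive_p1 recursive_id)
  qed
  {
    case 0
    then show ?case using if0 assms by blast
  next
    case (Suc k)
    have "recursive (\<lambda>n. if f n = 0 then h n else if f n - 1 = k then g n else h n)"
      using if0[OF Suc.prems assms(3) Suc.IH[OF recursive_pred[OF Suc.prems]]] .
    moreover have "(\<lambda>n. if f n = 0 then h n else if f n - 1 = k then g n else h n)
        = (\<lambda>n. if f n = Suc k then g n else h n)"
      by (rule ext) auto
    ultimately show ?case by simp
  }
qed

lemmas recursive_intros = recursive_id recursive_const recursive_Suc recursive_p1 recursive_p2
  recursive_pr recursive_pred recursive_if_eq

section \<open>An abstract machine for partial recursive functions\<close>

text \<open>
  \<open>Ev c x K\<close> evaluates code \<open>c\<close> at \<open>x\<close> and \<open>Rt v K\<close> returns \<open>v\<close> to the stack \<open>K\<close>, whose top frame is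
  \<open>Fr t d K'\<close>. A code is a pair of a tag and data; the tags \<open>0, ..., 7\<close> follow the order of the
  rules of \<^const>\<open>partrec\<close>. The frames wait for: \<open>1, 2\<close> the components of a pair, \<open>3\<close> the inner
  function of a composition, \<open>4\<close> a round of primitive recursion (data \<open>g, x, i\<close> and the number of
  remaining rounds), \<open>5\<close> a test of minimization. The empty stack is \<open>0 = prod_encode (0, 0)\<close>,
  so frame tag \<open>0\<close> marks the end of the computation.
\<close>

abbreviation (input) Ev :: "nat \<Rightarrow> nat \<Rightarrow> nat \<Rightarrow> nat" where "Ev c x K \<equiv> pr 0 (pr c (pr x K))"
abbreviation (input) Rt :: "nat \<Rightarrow> nat \<Rightarrow> nat" where "Rt v K \<equiv> pr 1 (pr v K)"
abbreviation (input) Fr :: "nat \<Rightarrow> nat \<Rightarrow> nat \<Rightarrow> nat" where "Fr t d K \<equiv> pr t (pr d K)"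

text \<open>All tags above \<open>6\<close> mean minimization, so every number is a code and
  \<open>ev_step\<close> is total.\<close>

definition ev_call :: "nat \<Rightarrow> nat \<Rightarrow> nat \<Rightarrow> nat \<Rightarrow> nat" where
  "ev_call t d x K =
    (if t = 0 then Rt 0 K
     else if t = 1 then Rt (Suc x) K
     else if t = 2 then Rt (pfst x) K
     else if t = 3 then Rt (psnd x) K
     else if t = 4 then Ev (pfst d) x (Fr 1 (pr (psnd d) x) K)
     else if t = 5 then Ev (psnd d) x (Fr 3 (pfst d) K)
     else if t = 6 then Ev (pfst d) (pfst x) (Fr 4 (pr (psnd d) (pr (pfst x) (pr 0 (psnd x)))) K)
     else Ev d (pr x 0) (Fr 5 (pr d (pr x 0)) K))"

text \<open>Frame tag \<open>0\<close> reproduces the state, which makes final states fixed points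
  of \<open>ev_step\<close>.\<close>

definition ev_return :: "nat \<Rightarrow> nat \<Rightarrow> nat \<Rightarrow> nat \<Rightarrow> nat" where
  "ev_return v t d K =
    (if t = 0 then Rt v (Fr t d K)
     else if t = 1 then Ev (pfst d) (psnd d) (Fr 2 v K)
     else if t = 2 then Rt (pr d v) K
     else if t = 3 then Ev d v K
     else if t = 4 then
       (if psnd (psnd (psnd d)) = 0 then Rt v K
        else Ev (pfst d) (pr (pfst (psnd d)) (pr (pfst (psnd (psnd d))) v))
          (Fr 4 (pr (pfst d) (pr (pfst (psnd d)) (pr (Suc (pfst (psnd (psnd d)))) (psnd (psnd (psnd d)) - 1)))) K))
     else
       (if v = 0 then Rt (psnd (psnd d)) K
        else Ev (pfst d) (pr (pfst (psnd d)) (Suc (psnd (psnd d))))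
          (Fr 5 (pr (pfst d) (pr (pfst (psnd d)) (Suc (psnd (psnd d))))) K)))"

definition ev_step :: "nat \<Rightarrow> nat" where
  "ev_step s =
    (if pfst s = 0
     then ev_call (pfst (pfst (psnd s))) (psnd (pfst (psnd s))) (pfst (psnd (psnd s))) (psnd (psnd (psnd s)))
     else if pfst s = 1
     then ev_return (pfst (psnd s)) (pfst (psnd (psnd s))) (pfst (psnd (psnd (psnd s)))) (psnd (psnd (psnd (psnd s))))
     else s)"

definition ev_final :: "nat \<Rightarrow> bool" where
  "ev_final s \<longleftrightarrow> pfst s = 1 \<and> pfst (psnd (psnd s)) = 0"

lemma ev_step_simps:
  "ev_step (Ev (pr t d) x K) = ev_call t d x K"
  "ev_step (Rt v (Fr t d K)) = ev_return v t d K"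
  by (simp_all add: ev_step_def)

lemma pr_0_0: "pr 0 0 = 0"
  by (simp add: prod_encode_def)

lemma prod_decode_0: "prod_decode 0 = (0, 0)"
  by (metis pr_0_0 prod_encode_inverse)

lemma ev_final_Rt: "ev_final (Rt v 0)"
  by (simp add: ev_final_def prod_decode_0)

lemma ev_step_final: "ev_final s \<Longrightarrow> ev_step s = s"
proof -
  assume f: "ev_final s"
  have "s = pr (pfst s) (pr (pfst (psnd s)) (pr (pfst (psnd (psnd s)))
      (pr (pfst (psnd (psnd (psnd s)))) (psnd (psnd (psnd (psnd s)))))))"
    by simp
  with f show ?thesis
    by (simp add: ev_step_def ev_final_def ev_return_def)
qed

lemma ev_steps_final: "ev_final s \<Longrightarrow> (ev_step ^^ n) s = s"
  by (induction n) (simp_all add: ev_step_final)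

lemma recursive_ev_step: "recursive f \<Longrightarrow> recursive (\<lambda>n. ev_step (f n))"
  unfolding ev_step_def ev_call_def ev_return_def by (intro recursive_intros)

lemma recursive_if_final:
  "recursive f \<Longrightarrow> recursive g \<Longrightarrow> recursive h \<Longrightarrow>
    recursive (\<lambda>n. if ev_final (f n) then g n else h n)"
proof -
  assume "recursive f" "recursive g" "recursive h"
  then have "recursive (\<lambda>n. if pfst (f n) = 1 then if pfst (psnd (psnd (f n))) = 0 then g n else h n else h n)"
    by (intro recursive_intros)
  moreover have "(\<lambda>n. if pfst (f n) = 1 then if pfst (psnd (psnd (f n))) = 0 then g n else h n else h n)
    = (\<lambda>n. if ev_final (f n) then g n else h n)"
    by (auto simp: ev_final_def)
  ultimately show ?thesis by simp
qed

section \<open>Correctness of the codes\<close>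

definition ev_reach :: "nat \<Rightarrow> nat \<Rightarrow> bool" where
  "ev_reach s s' \<longleftrightarrow> (\<exists>n. (ev_step ^^ n) s = s')"

lemma ev_reach_refl: "ev_reach s s"
  unfolding ev_reach_def by (rule exI[of _ 0]) simp

lemma ev_reach_trans [trans]: "ev_reach s s' \<Longrightarrow> ev_reach s' s'' \<Longrightarrow> ev_reach s s''"
  unfolding ev_reach_def by (metis funpow_add comp_apply)

lemma ev_reach_step: "ev_reach (ev_step s) s' \<Longrightarrow> ev_reach s s'"
  unfolding ev_reach_def by (metis funpow_Suc_right comp_apply)

text \<open>The arbitrary stack \<open>K\<close> makes correctness compositional. Nothing is claimed
  where \<open>f\<close> is undefined: divergence matters only for an outermost minimization of a
  total function, which is treated separately.\<close>

definition computes :: "nat \<Rightarrow> (nat \<Rightarrow> nat option) \<Rightarrow> bool" where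
  "computes c f \<longleftrightarrow> (\<forall>x v K. f x = Some v \<longrightarrow> ev_reach (Ev c x K) (Rt v K))"

lemma computesD: "computes c f \<Longrightarrow> f x = Some v \<Longrightarrow> ev_reach (Ev c x K) (Rt v K)"
  by (simp add: computes_def)

lemma computes_prim:
  assumes "computes c f" "computes d g"
  shows "computes (pr 6 (pr c d)) (\<lambda>n. case prod_decode n of (x, k) \<Rightarrow>
      rec_nat (f x) (\<lambda>i r. Option.bind r (\<lambda>y. g (pr x (pr i y)))) k)"
  unfolding computes_def
proof (intro allI impI)
  fix n v K
  let ?r = "\<lambda>x. rec_nat (f x) (\<lambda>i r. Option.bind r (\<lambda>y. g (pr x (pr i y))))"
  obtain x k where n: "n = pr x k" by (metis prod_decode_inverse surj_pair)
  assume "(case prod_decode n of (x, k) \<Rightarrow> ?r x k) = Some v"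
  then have v: "?r x k = Some v" by (simp add: n)
  let ?F = "\<lambda>i j. Fr 4 (pr d (pr x (pr i j))) K"
  \<comment> \<open>The total number of rounds is \<open>m + j\<close>, so the induction on
    \<open>m\<close> can move one round from the remaining to the completed ones.\<close>
  have loop: "ev_reach (Ev c x (?F 0 (m + j))) (Rt y (?F m j))" if "?r x m = Some y" for m j y
    using that
  proof (induction m arbitrary: j y)
    case 0
    then show ?case using computesD[OF assms(1)] by simp
  next
    case (Suc m)
    then obtain z where z: "?r x m = Some z" "g (pr x (pr m z)) = Some y"
      by (cases "?r x m") auto
    have "ev_reach (Ev c x (?F 0 (Suc m + j))) (Rt z (?F m (Suc j)))"
      using Suc.IH[OF z(1), of "Suc j"] by simp
    also have "ev_reach \<dots> (Ev d (pr x (pr m z)) (?F (Suc m) j))"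
      by (rule ev_reach_step) (simp add: ev_step_simps ev_return_def ev_reach_refl del: One_nat_def)
    also have "ev_reach \<dots> (Rt y (?F (Suc m) j))"
      using computesD[OF assms(2) z(2)] .
    finally show ?case .
  qed
  have "ev_reach (Ev (pr 6 (pr c d)) n K) (Ev c x (?F 0 (k + 0)))"
    by (rule ev_reach_step) (simp add: n ev_step_simps ev_call_def ev_reach_refl)
  also have "ev_reach \<dots> (Rt v (?F k 0))"
    using loop[OF v, of 0] .
  also have "ev_reach \<dots> (Rt v K)"
    by (rule ev_reach_step) (simp add: ev_step_simps ev_return_def ev_reach_refl del: One_nat_def)
  finally show "ev_reach (Ev (pr 6 (pr c d)) n K) (Rt v K)" .
qed

text \<open>Reaching the start of round \<open>m\<close> serves two purposes: it leads to the result
  of a successful search, and it shows that a failing search passes through infinitely many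
  states.\<close>

lemma mu_loop:
  assumes "computes c f" and "\<forall>i<m. \<exists>v>0. f (pr x i) = Some v"
  shows "ev_reach (Ev (pr 7 c) x K) (Ev c (pr x m) (Fr 5 (pr c (pr x m)) K))"
  using assms(2)
proof (induction m)
  case 0
  show ?case
    by (rule ev_reach_step) (simp add: ev_step_simps ev_call_def ev_reach_refl)
next
  case (Suc m)
  then obtain v where v: "v > 0" "f (pr x m) = Some v" by blast
  have "ev_reach (Ev (pr 7 c) x K) (Ev c (pr x m) (Fr 5 (pr c (pr x m)) K))"
    using Suc by simp
  also have "ev_reach \<dots> (Rt v (Fr 5 (pr c (pr x m)) K))"
    using computesD[OF assms(1) v(2)] .
  also have "ev_reach \<dots> (Ev c (pr x (Suc m)) (Fr 5 (pr c (pr x (Suc m))) K))"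
    by (rule ev_reach_step) (use v in \<open>simp add: ev_step_simps ev_return_def ev_reach_refl del: One_nat_def\<close>)
  finally show ?case .
qed

lemma mu_reach:
  assumes "computes c f" and k: "f (pr x k) = Some 0" "\<forall>i<k. \<exists>v>0. f (pr x i) = Some v"
  shows "ev_reach (Ev (pr 7 c) x K) (Rt k K)"
proof -
  have "ev_reach (Ev (pr 7 c) x K) (Ev c (pr x k) (Fr 5 (pr c (pr x k)) K))"
    using mu_loop[OF assms(1) k(2)] .
  also have "ev_reach \<dots> (Rt 0 (Fr 5 (pr c (pr x k)) K))"
    using computesD[OF assms(1) k(1)] .
  also have "ev_reach \<dots> (Rt k K)"
    by (rule ev_reach_step)
       (simp add: ev_step_simps ev_return_def ev_reach_refl del: One_nat_def)
  finally show ?thesis .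
qed

lemma computes_mu:
  assumes "computes c f"
  shows "computes (pr 7 c) (\<lambda>x.
      if \<exists>k. f (pr x k) = Some 0 \<and> (\<forall>i<k. \<exists>v>0. f (pr x i) = Some v)
      then Some (LEAST k. f (pr x k) = Some 0) else None)"
  unfolding computes_def
proof (intro allI impI)
  fix x v K
  assume "(if \<exists>k. f (pr x k) = Some 0 \<and> (\<forall>i<k. \<exists>v>0. f (pr x i) = Some v)
      then Some (LEAST k. f (pr x k) = Some 0) else None) = Some v"
  then obtain k where k: "f (pr x k) = Some 0" "\<forall>i<k. \<exists>v>0. f (pr x i) = Some v"
    and v: "v = (LEAST k. f (pr x k) = Some 0)"
    by (auto split: if_splits)
  have "v = k"
    unfolding v
  proof (rule Least_equality[where P = "\<lambda>k. f (pr x k) = Some 0", OF k(1)])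
    show "k \<le> y" if "f (pr x y) = Some 0" for y
      using k(2) that by (metis less_irrefl not_le option.inject)
  qed
  then show "ev_reach (Ev (pr 7 c) x K) (Rt v K)"
    using mu_reach[OF assms k] by simp
qed

theorem partrec_computes: "partrec f \<Longrightarrow> \<exists>c. computes c f"
proof (induction rule: partrec.induct)
  case zero
  have "computes (pr 0 0) (\<lambda>n. Some 0)"
    unfolding computes_def
    by (intro allI impI, rule ev_reach_step)
      (auto simp: ev_step_simps ev_call_def ev_reach_refl)
  then show ?case ..
next
  case succ
  have "computes (pr 1 0) (\<lambda>n. Some (Suc n))"
    unfolding computes_def
    by (intro allI impI, rule ev_reach_step)
      (auto simp: ev_step_simps ev_call_def ev_reach_refl)
  then show ?case ..
next
  case left
  have "computes (pr 2 0) (\<lambda>n. Some (pfst n))"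
    unfolding computes_def
    by (intro allI impI, rule ev_reach_step)
      (auto simp: ev_step_simps ev_call_def ev_reach_refl)
  then show ?case ..
next
  case right
  have "computes (pr 3 0) (\<lambda>n. Some (psnd n))"
    unfolding computes_def
    by (intro allI impI, rule ev_reach_step)
      (auto simp: ev_step_simps ev_call_def ev_reach_refl)
  then show ?case ..
next
  case (pair f g)
  then obtain c d where cd: "computes c f" "computes d g" by blast
  have "ev_reach (Ev (pr 4 (pr c d)) n K) (Rt (pr x y) K)"
    if "f n = Some x" "g n = Some y" for n x y K
  proof -
    have "ev_reach (Ev (pr 4 (pr c d)) n K) (Ev c n (Fr 1 (pr d n) K))"
      by (rule ev_reach_step) (simp add: ev_step_simps ev_call_def ev_reach_refl)
    also have "ev_reach \<dots> (Rt x (Fr 1 (pr d n) K))"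
      using computesD[OF cd(1) that(1)] .
    also have "ev_reach \<dots> (Ev d n (Fr 2 x K))"
      by (rule ev_reach_step) (simp add: ev_step_simps ev_return_def ev_reach_refl del: One_nat_def)
    also have "ev_reach \<dots> (Rt y (Fr 2 x K))"
      using computesD[OF cd(2) that(2)] .
    also have "ev_reach \<dots> (Rt (pr x y) K)"
      by (rule ev_reach_step) (simp add: ev_step_simps ev_return_def ev_reach_refl del: One_nat_def)
    finally show ?thesis .
  qed
  then have "computes (pr 4 (pr c d))
      (\<lambda>n. Option.bind (f n) (\<lambda>x. Option.bind (g n) (\<lambda>y. Some (pr x y))))"
    unfolding computes_def by (auto simp: bind_eq_Some_conv)
  then show ?case ..
next
  case (comp f g)
  then obtain c d where cd: "computes c f" "computes d g" by blast
  have "ev_reach (Ev (pr 5 (pr c d)) n K) (Rt y K)"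
    if "g n = Some x" "f x = Some y" for n x y K
  proof -
    have "ev_reach (Ev (pr 5 (pr c d)) n K) (Ev d n (Fr 3 c K))"
      by (rule ev_reach_step) (simp add: ev_step_simps ev_call_def ev_reach_refl)
    also have "ev_reach \<dots> (Rt x (Fr 3 c K))"
      using computesD[OF cd(2) that(1)] .
    also have "ev_reach \<dots> (Ev c x K)"
      by (rule ev_reach_step) (simp add: ev_step_simps ev_return_def ev_reach_refl del: One_nat_def)
    also have "ev_reach \<dots> (Rt y K)"
      using computesD[OF cd(1) that(2)] .
    finally show ?thesis .
  qed
  then have "computes (pr 5 (pr c d)) (\<lambda>n. Option.bind (g n) f)"
    unfolding computes_def by (auto simp: bind_eq_Some_conv)
  then show ?case ..
next
  case (prim f g)
  then show ?case using computes_prim by blast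
next
  case (mu f)
  then show ?case using computes_mu by blast
qed

lemma recursive_computes:
  assumes "recursive f"
  shows "\<exists>c. \<forall>x K. ev_reach (Ev c x K) (Rt (f x) K)"
  using partrec_computes[OF assms[unfolded recursive_def]] by (auto simp: computes_def)

section \<open>Hardness of the halting problem\<close>

definition halting :: "nat set" where
  "halting = {s. \<exists>n. ev_final ((ev_step ^^ n) s)}"

text \<open>The code is the unbounded search for an \<open>m\<close> with \<open>R n m = 0\<close>.
  As \<open>computes\<close> is silent about divergence, a search without success is followed round
  by round with \<open>mu_loop\<close>.\<close>

lemma Sigma01_reduces_to_halting:
  assumes "Sigma01 A"
  shows "\<exists>c. \<forall>n. n \<in> A \<longleftrightarrow> Ev c n 0 \<in> halting"
proof -
  obtain R where R: "recursive2 R" "\<And>n. n \<in> A \<longleftrightarrow> (\<exists>m. R n m = 0)"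
    using assms unfolding Sigma01_def by blast
  let ?R = "\<lambda>n. Some (R (pfst n) (psnd n))"
  have "partrec ?R"
    using R(1) by (simp add: recursive2_def recursive_def case_prod_beta)
  then obtain c where c: "computes c ?R" using partrec_computes by blast
  have "n \<in> A \<longleftrightarrow> Ev (pr 7 c) n 0 \<in> halting" for n
  proof
    assume "n \<in> A"
    define k where "k = (LEAST m. R n m = 0)"
    have k: "R n k = 0" "\<forall>i<k. R n i > 0"
      using R(2) \<open>n \<in> A\<close> unfolding k_def by (auto intro: LeastI_ex dest: not_less_Least)
    then have "ev_reach (Ev (pr 7 c) n 0) (Rt k 0)"
      by (intro mu_reach[OF c]) auto
    then show "Ev (pr 7 c) n 0 \<in> halting"
      using ev_final_Rt[of k] unfolding halting_def ev_reach_def by (metis (mono_tags) mem_Collect_eq)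
  next
    let ?s = "Ev (pr 7 c) n 0"
    assume "?s \<in> halting"
    then obtain k where k: "ev_final ((ev_step ^^ k) ?s)" unfolding halting_def by blast
    show "n \<in> A"
    proof (rule ccontr)
      assume "n \<notin> A"
      then have "\<forall>m. R n m > 0" using R(2) by auto
      then have loop: "ev_reach ?s (Ev c (pr n m) (Fr 5 (pr c (pr n m)) 0))" for m
        using mu_loop[OF c] by auto
      define t where "t = (ev_step ^^ k) ?s"
      \<comment> \<open>a final state is a fixed point, so the run would visit only finitely many states\<close>
      have fin: "(ev_step ^^ j) ?s \<in> (\<lambda>j. (ev_step ^^ j) ?s) ` {..k}" for j
      proof (cases "j \<le> k")
        case False
        then have "(ev_step ^^ j) ?s = (ev_step ^^ (j - k + k)) ?s" by simp
        also have "\<dots> = (ev_step ^^ (j - k)) t"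
          by (simp only: t_def funpow_add comp_apply)
        finally have "(ev_step ^^ j) ?s = (ev_step ^^ (j - k)) t" .
        then show ?thesis using ev_steps_final[OF k] t_def by auto
      qed auto
      have "range (\<lambda>m. Ev c (pr n m) (Fr 5 (pr c (pr n m)) 0)) \<subseteq> (\<lambda>j. (ev_step ^^ j) ?s) ` {..k}"
      proof (rule image_subsetI)
        fix m
        show "Ev c (pr n m) (Fr 5 (pr c (pr n m)) 0) \<in> (\<lambda>j. (ev_step ^^ j) ?s) ` {..k}"
          using loop[of m] fin unfolding ev_reach_def by metis
      qed
      then have "finite (range (\<lambda>m. Ev c (pr n m) (Fr 5 (pr c (pr n m)) 0)))"
        by (rule finite_subset) simp
      \<comment> \<open>The round number \<open>m\<close> is part of the state.\<close>
      moreover have "inj (\<lambda>m. Ev c (pr n m) (Fr 5 (pr c (pr n m)) 0))"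
        by (auto intro: injI)
      ultimately show False using finite_imageD infinite_UNIV_nat by blast
    qed
  qed
  then show ?thesis by blast
qed

section \<open>Runs of chronological machines\<close>

abbreviation out :: "config \<Rightarrow> percept list" where "out c \<equiv> snd (snd (snd c))"

definition run :: "machine \<Rightarrow> nat \<Rightarrow> config \<Rightarrow> config" where
  "run T n c = (step T ^^ n) c"

lemma run_0 [simp]: "run T 0 c = c"
  by (simp add: run_def)

lemma run_Suc: "run T (Suc n) c = step T (run T n c)"
  by (simp add: run_def)

lemma run_Suc_left: "run T (Suc n) c = run T n (step T c)"
  by (simp add: run_def funpow_swap1)

lemma run_add: "run T (m + n) c = run T n (run T m c)"
  by (induction n) (simp_all add: run_Suc)

lemma output_after_run: "output_after T n p a = out (run T n (0, p, a, []))"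
  by (simp add: output_after_def run_def case_prod_beta)

lemma mem_machine_output: "e \<in> machine_output T p a \<longleftrightarrow> (\<exists>n. prefix e (out (run T n (0, p, a, []))))"
  by (simp add: machine_output_def output_after_run)

lemma prefix_out_step: "prefix (out c) (out (step T c))"
  by (cases c) (auto split: instr.splits list.splits)

lemma prefix_out_run: "prefix (out c) (out (run T n c))"
  by (induction n) (auto simp: run_Suc intro: prefix_order.trans[OF _ prefix_out_step])

lemma out_run_mono: "m \<le> n \<Longrightarrow> prefix (out (run T m c)) (out (run T n c))"
  by (metis le_add_diff_inverse prefix_out_run run_add)

lemma machine_output_comparable:
  assumes "e \<in> machine_output T p a" "e' \<in> machine_output T p a"
  shows "prefix e e' \<or> prefix e' e"
proof -
  obtain m n where "prefix e (out (run T m (0, p, a, [])))" "prefix e' (out (run T n (0, p, a, [])))"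
    using assms unfolding mem_machine_output by blast
  then have "prefix e (out (run T (max m n) (0, p, a, [])))" "prefix e' (out (run T (max m n) (0, p, a, [])))"
    using out_run_mono[of _ "max m n"] by (meson max.cobounded1 max.cobounded2 prefix_order.trans)+
  then show ?thesis by (rule prefix_same_cases)
qed

lemma machine_output_prefix:
  "e \<in> machine_output T p a \<Longrightarrow> prefix e' e \<Longrightarrow> e' \<in> machine_output T p a"
  unfolding mem_machine_output by (meson prefix_order.trans)

lemma Nil_in_machine_output: "[] \<in> machine_output T p a"
  by (simp add: mem_machine_output)

section \<open>Lengthening and cutting the input tapes\<close>

lemma run_append_tapes:
  assumes "run T n (s, p, a, u) = (s', p', a', u')"
  shows "\<exists>m. run T m (s, p @ p2, a @ a2, u) = (s', p' @ p2, a' @ a2, u')"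
  using assms
proof (induction n arbitrary: s' p' a' u')
  case 0
  then show ?case by (intro exI[of _ 0]) simp
next
  case (Suc n)
  obtain s1 q1 b1 u1 where c1: "run T n (s, p, a, u) = (s1, q1, b1, u1)"
    by (metis prod_cases4)
  obtain m where m: "run T m (s, p @ p2, a @ a2, u) = (s1, q1 @ p2, b1 @ a2, u1)"
    using Suc.IH[OF c1] by blast
  have step: "step T (s1, q1, b1, u1) = (s', p', a', u')"
    using Suc.prems c1 by (simp add: run_Suc)
  show ?case
  proof (cases "step T (s1, q1, b1, u1) = (s1, q1, b1, u1)")
    case True
    with step m show ?thesis by auto
  next
    case False
    then have "step T (s1, q1 @ p2, b1 @ a2, u1) = (s', p' @ p2, a' @ a2, u')"
      using step by (auto split: instr.splits list.splits)
    then have "run T (Suc m) (s, p @ p2, a @ a2, u) = (s', p' @ p2, a' @ a2, u')"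
      using m by (simp add: run_Suc)
    then show ?thesis by blast
  qed
qed

text \<open>A machine never notices the end of a tape, it only waits there. Steps spent waiting are
  dropped in the longer run, so \<open>run_append_tapes\<close> cannot keep the number of
  steps.\<close>

lemma machine_output_append:
  assumes "e \<in> machine_output T p a"
  shows "e \<in> machine_output T (p @ p2) (a @ a2)"
proof -
  obtain n where "prefix e (out (run T n (0, p, a, [])))"
    using assms unfolding mem_machine_output by blast
  moreover obtain s q b u where "run T n (0, p, a, []) = (s, q, b, u)"
    by (metis prod_cases4)
  ultimately show ?thesis
    using run_append_tapes[of T n 0 p a "[]" s q b u p2 a2] unfolding mem_machine_output
    by (metis snd_conv)
qed

lemma machine_output_prefix_program:
  "e \<in> machine_output T p a \<Longrightarrow> prefix p p' \<Longrightarrow> e \<in> machine_output T p' a"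
  using machine_output_append[of e T p a _ "[]"] by (auto elim: prefixE)

lemma run_action_suffix:
  "run T n (s, p, a, u) = (s', p', a', u') \<Longrightarrow> suffix a' a"
proof (induction n arbitrary: s' p' a' u')
  case (Suc n)
  obtain s1 q1 b1 u1 where c1: "run T n (s, p, a, u) = (s1, q1, b1, u1)"
    by (metis prod_cases4)
  have "step T (s1, q1, b1, u1) = (s', p', a', u')"
    using Suc.prems c1 by (simp add: run_Suc)
  then have "suffix a' b1"
    by (auto split: instr.splits list.splits simp: suffix_Cons)
  then show ?case using Suc.IH[OF c1] by (meson suffix_order.trans)
qed simp

text \<open>The unread actions only shrink, so if \<open>a2\<close> is unread at the end, it was
  unread all along and its presence was never observed.\<close>

lemma run_cut_actions:
  assumes "run T n (s, p, a1 @ a2, u) = (s', p', b @ a2, u')"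
  shows "run T n (s, p, a1, u) = (s', p', b, u')"
  using assms
proof (induction n arbitrary: s' p' b u')
  case (Suc n)
  obtain s1 q1 b1 u1 where c1: "run T n (s, p, a1 @ a2, u) = (s1, q1, b1, u1)"
    by (metis prod_cases4)
  have step: "step T (s1, q1, b1, u1) = (s', p', b @ a2, u')"
    using Suc.prems c1 by (simp add: run_Suc)
  then have "b1 = b @ a2 \<or> (\<exists>x. instr_at T s1 = Read_Action \<and> b1 = (x # b) @ a2)"
    by (auto split: instr.splits list.splits)
  then obtain d where d: "b1 = d @ a2" "d = b \<or> (\<exists>x. instr_at T s1 = Read_Action \<and> d = x # b)"
    by blast
  from Suc.IH[of s1 q1 d u1] c1 d(1) have "run T n (s, p, a1, u) = (s1, q1, d, u1)"
    by simp
  moreover have "step T (s1, q1, d, u1) = (s', p', b, u')"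
    using step d by (auto split: instr.splits list.splits)
  ultimately show ?case by (simp add: run_Suc)
qed simp

text \<open>Only the output has to stop; the machine may compute forever, as in a search without
  success.\<close>

definition halted :: "machine \<Rightarrow> config \<Rightarrow> bool" where
  "halted T c \<longleftrightarrow> (\<forall>n. out (run T n c) = out c)"

lemma halted_fixpoint: "step T c = c \<Longrightarrow> halted T c"
proof -
  assume "step T c = c"
  then have "run T n c = c" for n
    by (induction n) (simp_all add: run_Suc)
  then show ?thesis by (simp add: halted_def)
qed

lemma halted_step: "halted T c \<Longrightarrow> halted T (step T c) \<and> out (step T c) = out c"
  unfolding halted_def by (metis run_0 run_Suc run_Suc_left)

lemma halted_machine_output:
  assumes "run T n (0, p, a, []) = c" "halted T c" "e \<in> machine_output T p a"
  shows "prefix e (out c)"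
proof -
  obtain m where "prefix e (out (run T m (0, p, a, [])))"
    using assms(3) unfolding mem_machine_output by blast
  then have "prefix e (out (run T (n + m) (0, p, a, [])))"
    using out_run_mono[of m "n + m"] by (meson le_add2 prefix_order.trans)
  then show ?thesis using assms(1,2) by (simp add: run_add halted_def)
qed

text \<open>Percept \<open>t\<close> is then written before action \<open>t + 1\<close> is read.\<close>

lemma chronologicalI:
  assumes reads: "\<And>n p a s p' a' u. run T n (0, p, a, []) = (s, p', a', u) \<Longrightarrow>
    length a \<le> Suc (length a' + length u)"
  shows "chronological T"
  unfolding chronological_def
proof (intro allI impI iffI)
  fix p and a :: "action list" and t and e :: "percept list"
  assume t: "t \<le> length a" "length e \<le> t"
  {
    assume "e \<in> machine_output T p (take t a)"
    from machine_output_append[OF this, of "[]" "drop t a"] show "e \<in> machine_output T p a"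
      by simp
  next
    assume "e \<in> machine_output T p a"
    then have ex: "\<exists>n. prefix e (out (run T n (0, p, a, [])))"
      unfolding mem_machine_output .
    \<comment> \<open>The step that completes \<open>e\<close> is a write. Before it fewer than
      \<open>length e\<close> percepts are out, so by \<open>reads\<close> at most \<open>t\<close>
      actions have been consumed.\<close>
    define n where "n = (LEAST n. prefix e (out (run T n (0, p, a, []))))"
    have n: "prefix e (out (run T n (0, p, a, [])))"
      unfolding n_def using ex by (rule LeastI_ex)
    have min: "\<not> prefix e (out (run T m (0, p, a, [])))" if "m < n" for m
      using not_less_Least[OF that[unfolded n_def]] .
    show "e \<in> machine_output T p (take t a)"
    proof (cases n)
      case 0
      then show ?thesis using n by (simp add: Nil_in_machine_output)
    next
      case (Suc m)
      obtain s q b u where c: "run T m (0, p, a, []) = (s, q, b, u)"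
        by (metis prod_cases4)
      obtain s' q' b' u' where c': "run T n (0, p, a, []) = (s', q', b', u')"
        by (metis prod_cases4)
      have st: "step T (s, q, b, u) = (s', q', b', u')"
        using c c' Suc by (simp add: run_Suc)
      have ne: "\<not> prefix e u" "prefix e u'"
        using min[of m] n Suc c c' by auto
      then have "b' = b" and "prefix u u'"
        using st by (auto split: instr.splits list.splits)
      with ne have "length u < length e"
        using prefix_length_prefix[of e u' u] by linarith
      then have len: "length a \<le> t + length b'"
        using reads[OF c] t unfolding \<open>b' = b\<close> by linarith
      have "suffix (drop t a) b'"
        using suffix_drop run_action_suffix[OF c']
        by (rule suffix_length_suffix) (use len in simp)
      then obtain d where "b' = d @ drop t a" by (auto elim: suffixE)
      then have "run T n (0, p, take t a, []) = (s', q', d, u')"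
        using c' run_cut_actions[of T n 0 p "take t a" "drop t a" "[]" s' q' d u'] by simp
      then show ?thesis
        unfolding mem_machine_output using ne(2) by (intro exI[of _ n]) simp
    qed
  }
qed

text \<open>The condition \<open>m > 0\<close> makes the time of \<open>U\<close> exceed every
  bound, so all output of \<open>U\<close> is eventually matched by \<open>T\<close>. The second
  alternative allows giving up the relation \<open>M\<close> once both machines are silent with
  equal output.\<close>

lemma machine_output_simulation:
  assumes start: "run U n\<^sub>0 (0, q, a, []) = c\<^sub>0" "M c\<^sub>0 (0, p, a, [])"
    and out: "\<And>c d. M c d \<Longrightarrow> out c = out d"
    and sim: "\<And>c d. M c d \<Longrightarrow> \<exists>m>0. M (run U m c) (step T d) \<or>
      halted U (run U m c) \<and> halted T d \<and> out (run U m c) = out d"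
  shows "machine_output U q a = machine_output T p a"
proof -
  let ?d = "(0, p, a, []) :: config"
  have sync: "\<exists>m\<ge>k. M (run U m c\<^sub>0) (run T k ?d) \<or>
      halted U (run U m c\<^sub>0) \<and> halted T (run T k ?d) \<and> out (run U m c\<^sub>0) = out (run T k ?d)" for k
  proof (induction k)
    case 0
    then show ?case using start(2) by (intro exI[of _ 0]) simp
  next
    case (Suc k)
    then obtain m where m: "m \<ge> k" and disj: "M (run U m c\<^sub>0) (run T k ?d) \<or>
      halted U (run U m c\<^sub>0) \<and> halted T (run T k ?d) \<and> out (run U m c\<^sub>0) = out (run T k ?d)"
      by blast
    from disj show ?case
    proof
      assume "M (run U m c\<^sub>0) (run T k ?d)"
      from sim[OF this] obtain j where j: "j > 0" "M (run U j (run U m c\<^sub>0)) (step T (run T k ?d)) \<or>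
        halted U (run U j (run U m c\<^sub>0)) \<and> halted T (run T k ?d) \<and>
        out (run U j (run U m c\<^sub>0)) = out (run T k ?d)"
        by blast
      then show ?thesis
        using m by (intro exI[of _ "m + j"]) (auto simp: run_add run_Suc dest: halted_step)
    next
      assume "halted U (run U m c\<^sub>0) \<and> halted T (run T k ?d) \<and> out (run U m c\<^sub>0) = out (run T k ?d)"
      then show ?thesis
        using m by (intro exI[of _ "Suc m"]) (simp add: run_Suc halted_step)
    qed
  qed
  have sync': "\<exists>m\<ge>k. out (run U m c\<^sub>0) = out (run T k ?d)" for k
    using sync[of k] out by blast
  show ?thesis
  proof (intro set_eqI iffI)
    fix e assume "e \<in> machine_output T p a"
    then obtain k where "prefix e (out (run T k ?d))" unfolding mem_machine_output by blast
    with sync'[of k] have "\<exists>m. prefix e (out (run U m c\<^sub>0))" by metis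
    then show "e \<in> machine_output U q a"
      unfolding mem_machine_output start(1)[symmetric] run_add[symmetric] by blast
  next
    fix e assume "e \<in> machine_output U q a"
    then obtain k where "prefix e (out (run U k (0, q, a, [])))" unfolding mem_machine_output by blast
    then have k: "prefix e (out (run U (n\<^sub>0 + k) (0, q, a, [])))"
      using out_run_mono[of k "n\<^sub>0 + k"] by (meson le_add2 prefix_order.trans)
    obtain m where m: "m \<ge> k" "out (run U m c\<^sub>0) = out (run T k ?d)" using sync' by blast
    from k have "prefix e (out (run U m c\<^sub>0))"
      using out_run_mono[OF m(1), of U c\<^sub>0] by (auto simp: run_add start(1) intro: prefix_order.trans)
    then show "e \<in> machine_output T p a" unfolding mem_machine_output m(2) by blast
  qed
qed

text \<open>
  Cutting the actions off at the current position blocks the run here, so by chronology the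
  uncut run cannot write the next percept either.
\<close>

lemma chronological_halted:
  assumes "chronological T"
    and c: "run T n (0, p, a, []) = (s, p', b, u)" "instr_at T s = Read_Action"
    and reads: "length a = Suc (length b + length u)"
  shows "halted T (s, p', b, u)"
proof -
  \<comment> \<open>Exactly \<open>?t\<close> actions have been read, so \<open>b\<close> is
    \<open>drop ?t a\<close>, and the next percept, which has number \<open>?t\<close>, must not
    depend on it.\<close>
  let ?t = "Suc (length u)"
  have "out (run T k (s, p', b, u)) = u" for k
  proof (rule ccontr)
    let ?u = "out (run T k (s, p', b, u))"
    assume "?u \<noteq> u"
    then have "length u < length ?u"
      using prefix_out_run[of "(s, p', b, u)" T k] 
      by (auto intro!: prefix_length_less simp: strict_prefix_def)
    let ?e = "take ?t ?u"
    have "?e \<in> machine_output T p a"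
      unfolding mem_machine_output by (rule exI[of _ "n + k"]) (simp add: run_add c(1) take_is_prefix)
    then have e: "?e \<in> machine_output T p (take ?t a)"
      using \<open>chronological T\<close>[unfolded chronological_def, rule_format, of ?t a ?e p] reads by simp
    have "suffix b (drop ?t a)"
      using run_action_suffix[OF c(1)] suffix_drop
      by (rule suffix_length_suffix) (use reads in simp)
    then obtain d where d: "drop ?t a = d @ b" by (auto elim: suffixE)
    from arg_cong[OF d, of length] have "d = []" using reads by simp
    with d have b: "b = drop ?t a" by simp
    have "run T n (0, p, take ?t a @ drop ?t a, []) = (s, p', [] @ drop ?t a, u)"
      using c(1) b by simp
    from run_cut_actions[OF this] have "run T n (0, p, take ?t a, []) = (s, p', [], u)" .
    moreover have "halted T (s, p', [], u)"
      by (rule halted_fixpoint) (simp add: c(2))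
    ultimately have "prefix ?e u"
      using halted_machine_output[OF _ _ e] by fastforce
    then show False using \<open>length u < length ?u\<close> by (auto dest: prefix_length_le)
  qed
  then show ?thesis by (simp add: halted_def)
qed

section \<open>The universal machine\<close>

definition instr_decode :: "nat \<Rightarrow> instr" where
  "instr_decode n =
    (if n = 1 then Read_Program else if n = 2 then Read_Action
     else if n = 3 then Write (False, False) else if n = 4 then Write (False, True)
     else if n = 5 then Write (True, False) else if n = 6 then Write (True, True)
     else Compute)"

lemma instr_decode_encode: "instr_decode (instr_encode i) = i"
proof (cases i)
  case (Write e)
  then show ?thesis by (cases e) (auto simp: instr_decode_def)
qed (auto simp: instr_decode_def)

lemma instr_encode_decode: "instr_encode (instr_decode n) =
    (if n = 1 then 1 else if n = 2 then 2 else if n = 3 then 3 else if n = 4 then 4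
     else if n = 5 then 5 else if n = 6 then 6 else 0)"
  by (simp add: instr_decode_def)

text \<open>
  States have the form \<open>pr i (pr ph d)\<close>, where \<open>i\<close> is the code of the instruction and \<open>ph\<close> the phase:
  \<^item> \<open>0, 1\<close>: count the leading ones of the program; no ones select the environment, one to three
    ones are wasted, and \<open>n + 4\<close> ones simulate the machine with code \<open>n\<close>.
  \<^item> \<open>2, 3\<close>: count the actions \<open>Alpha\<close>; \<open>4\<close>: answer the first \<open>Beta\<close>; \<open>5\<close>: read the deciding action;
    \<open>6\<close>: flip a coin by reading a program bit; \<open>7\<close>: run the abstract machine; \<open>8\<close>: reward forever.
  \<^item> \<open>9\<close>: compute the instruction of the simulated machine; \<open>10\<close>: execute it; \<open>11\<close>: compute the
    next state. The data contain the code \<open>c\<close> (of the pair of the two functions), the simulated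
    state \<open>s\<close> and a credit \<open>k\<close>.
  \<^item> \<open>12\<close>: loop.

  The credit is one plus the number of percepts written minus the number of actions read.
  Refusing to read an action without credit makes the machine chronological whatever it simulates, and does not
  affect chronological machines by \<open>chronological_halted\<close>.
\<close>

definition dead :: nat where
  "dead = pr 0 (pr 12 0)"

definition u_fetch :: "nat \<Rightarrow> nat \<Rightarrow> nat \<Rightarrow> nat" where
  "u_fetch c k s = pr 0 (pr 9 (pr (pr c (pr k s)) (Ev (pfst c) s 0)))"

text \<open>The subtraction of four is iterated because \<open>recursive_intros\<close> knows only
  the predecessor. Initial credit \<open>1\<close> permits reading the first action before any
  percept is written.\<close>

definition u_start :: "nat \<Rightarrow> nat" where
  "u_start n =
    (if n = 0 then pr 2 (pr 2 0)
     else if n = 1 then dead else if n = 2 then dead else if n = 3 then dead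
     else u_fetch (n - 1 - 1 - 1 - 1) 1 0)"

definition u_exec :: "nat \<Rightarrow> nat \<Rightarrow> nat \<Rightarrow> nat \<Rightarrow> nat" where
  "u_exec i c k s =
    (if i = 0 then pr 0 (pr 10 (pr c (pr k s)))
     else if i = 1 then pr 1 (pr 10 (pr c (pr k s)))
     else if i = 2 then (if k = 0 then dead else pr 2 (pr 10 (pr c (pr (k - 1) s))))
     else if i = 3 then pr 3 (pr 10 (pr c (pr (Suc k) s)))
     else if i = 4 then pr 4 (pr 10 (pr c (pr (Suc k) s)))
     else if i = 5 then pr 5 (pr 10 (pr c (pr (Suc k) s)))
     else if i = 6 then pr 6 (pr 10 (pr c (pr (Suc k) s)))
     else dead)"

text \<open>Phase \<open>8\<close> writes rewards without reading further actions. Chronology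
  permits percepts that come early; it forbids actions that are read early.\<close>

definition u_next :: "nat \<Rightarrow> nat \<Rightarrow> nat \<Rightarrow> nat" where
  "u_next ph d x =
    (if ph = 0 then pr 1 (pr 1 0)
     else if ph = 1 then (if x = 0 then u_start d else pr 1 (pr 1 (Suc d)))
     else if ph = 2 then (if x = 0 then pr 3 (pr 3 d) else pr 3 (pr 4 d))
     else if ph = 3 then pr 2 (pr 2 (Suc d))
     else if ph = 4 then pr 2 (pr 5 d)
     else if ph = 5 then (if x = 0 then pr 1 (pr 6 0) else pr 0 (pr 7 d))
     else if ph = 6 then (if x = 0 then dead else pr 4 (pr 8 0))
     else if ph = 7 then (if ev_final d then pr 4 (pr 8 0) else pr 0 (pr 7 (ev_step d)))
     else if ph = 8 then pr 4 (pr 8 0)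
     else if ph = 9 then
       (if ev_final (psnd d)
        then u_exec (pfst (psnd (psnd d))) (pfst (pfst d)) (pfst (psnd (pfst d))) (psnd (psnd (pfst d)))
        else pr 0 (pr 9 (pr (pfst d) (ev_step (psnd d)))))
     else if ph = 10 then pr 0 (pr 11 (pr d (Ev (psnd (pfst d)) (pr (psnd (psnd d)) x) 0)))
     else if ph = 11 then
       (if ev_final (psnd d)
        then u_fetch (pfst (pfst d)) (pfst (psnd (pfst d))) (pfst (psnd (psnd d)))
        else pr 0 (pr 11 (pr (pfst d) (ev_step (psnd d)))))
     else dead)"

definition U :: machine where
  "U = \<lparr>instr_at = (\<lambda>s. instr_decode (pfst s)),
        next_state = (\<lambda>s x. u_next (pfst (psnd s)) (psnd (psnd s)) x)\<rparr>"

lemma U_simps [simp]: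
  "instr_at U (pr i z) = instr_decode i"
  "next_state U (pr i (pr ph d)) x = u_next ph d x"
  by (simp_all add: U_def)

lemma effective_U: "effective U"
proof -
  have "recursive (\<lambda>s. instr_encode (instr_at U s))"
    unfolding U_def instr_encode_decode machine.simps by (intro recursive_intros)
  moreover have "recursive2 (next_state U)"
    unfolding recursive2_def U_def case_prod_beta machine.simps u_next_def u_start_def u_fetch_def
      u_exec_def dead_def
    by (intro recursive_intros recursive_if_final recursive_ev_step)
  ultimately show ?thesis by (simp add: effective_def)
qed

text \<open>
  \<open>u_inv s r w\<close>: state \<open>s\<close> is possible after reading \<open>r\<close> actions and writing \<open>w\<close> percepts. In phase
  \<open>10\<close> the credit already accounts for the instruction about to be executed.
\<close>

inductive u_inv :: "nat \<Rightarrow> nat \<Rightarrow> nat \<Rightarrow> bool" where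
  "u_inv (pr 0 (pr 0 d)) 0 0"
| "u_inv (pr 1 (pr 1 d)) 0 0"
| "u_inv (pr 2 (pr 2 d)) w w"
| "u_inv (pr 3 (pr 3 d)) (Suc w) w"
| "u_inv (pr 3 (pr 4 d)) (Suc w) w"
| "u_inv (pr 2 (pr 5 d)) w w"
| "r \<le> Suc w \<Longrightarrow> u_inv (pr 1 (pr 6 d)) r w"
| "r \<le> Suc w \<Longrightarrow> u_inv (pr 0 (pr 7 d)) r w"
| "r \<le> Suc w \<Longrightarrow> u_inv (pr 4 (pr 8 d)) r w"
| "k + r = Suc w \<Longrightarrow> u_inv (pr 0 (pr 9 (pr (pr c (pr k s)) e))) r w"
| "k + r = Suc w \<Longrightarrow> u_inv (pr 0 (pr 11 (pr (pr c (pr k s)) e))) r w"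
| "i \<le> 1 \<Longrightarrow> k + r = Suc w \<Longrightarrow> u_inv (pr i (pr 10 (pr c (pr k s)))) r w"
| "k + r = w \<Longrightarrow> u_inv (pr 2 (pr 10 (pr c (pr k s)))) r w"
| "i \<in> {3, 4, 5, 6} \<Longrightarrow> k + r = Suc w \<Longrightarrow> u_inv (pr i (pr 10 (pr c (pr (Suc k) s)))) r w"
| "r \<le> Suc w \<Longrightarrow> u_inv (pr 0 (pr 12 d)) r w"

lemma u_inv_le: "u_inv s r w \<Longrightarrow> r \<le> Suc w"
  by (induction rule: u_inv.induct) auto

lemma u_inv_exec:
  assumes "k + r = Suc w"
  shows "u_inv (u_exec i c k s) r w"
proof -
  have r: "r \<le> Suc w" using assms by simp
  consider "i \<le> 1" | "i = 2" "k = 0" | "i = 2" "k \<noteq> 0" | "i \<in> {3, 4, 5, 6}" | "i > 6"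
    by fastforce
  then show ?thesis
  proof cases
    case 1
    then show ?thesis using u_inv.intros(12)[OF 1 assms, of c s] by (auto simp: u_exec_def le_Suc_eq)
  next
    case 3
    then show ?thesis using u_inv.intros(13)[of "k - 1" r w c s] assms by (simp add: u_exec_def)
  next
    case 4
    then show ?thesis using u_inv.intros(14)[OF 4 assms, of c s] by (auto simp: u_exec_def)
  qed (use u_inv.intros(15)[OF r, of 0] in \<open>simp_all add: u_exec_def dead_def\<close>)
qed

lemma u_inv_start: "u_inv (u_start n) 0 0"
  unfolding u_start_def dead_def u_fetch_def by (auto intro!: u_inv.intros)

definition reads :: "instr \<Rightarrow> nat" where
  "reads i = (if i = Read_Action then Suc 0 else 0)"

definition writes :: "instr \<Rightarrow> nat" where
  "writes i = (case i of Write e \<Rightarrow> Suc 0 | _ \<Rightarrow> 0)"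

lemma u_inv_step:
  assumes "u_inv s r w"
  shows "u_inv (next_state U s x) (r + reads (instr_at U s)) (w + writes (instr_at U s))"
  using assms
proof (cases rule: u_inv.cases)
  case 10
  then show ?thesis by (auto simp: u_next_def instr_decode_def reads_def writes_def
      intro!: u_inv.intros u_inv_exec)
next
  case (12 i)
  then show ?thesis
    by (cases i) (auto simp: u_next_def instr_decode_def reads_def writes_def intro!: u_inv.intros)
qed (auto simp: u_next_def instr_decode_def reads_def writes_def dead_def u_fetch_def
      intro!: u_inv.intros u_inv_start simp del: One_nat_def)

lemma u_inv_run:
  assumes "run U n (0, p, a, []) = (s, p', a', u)"
  shows "\<exists>r. length a = r + length a' \<and> u_inv s r (length u)"
  using assms
proof (induction n arbitrary: s p' a' u)
  case 0
  moreover have "u_inv 0 0 0"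
    using u_inv.intros(1)[of 0] by (simp add: pr_0_0)
  ultimately show ?case by auto
next
  case (Suc n)
  obtain s1 q1 b1 u1 where c1: "run U n (0, p, a, []) = (s1, q1, b1, u1)"
    by (metis prod_cases4)
  from Suc.IH[OF c1] obtain r where r: "length a = r + length b1" "u_inv s1 r (length u1)"
    by blast
  have "step U (s1, q1, b1, u1) = (s, p', a', u)"
    using Suc.prems c1 by (simp add: run_Suc)
  then consider "(s, p', a', u) = (s1, q1, b1, u1)"
    | x where "s = next_state U s1 x" "length b1 = length a' + reads (instr_at U s1)"
        "length u = length u1 + writes (instr_at U s1)"
    by (auto split: instr.splits list.splits simp: reads_def writes_def)
  then show ?case
  proof cases
    case 1
    then show ?thesis using r by auto
  next
    case 2
    then show ?thesis using r u_inv_step[OF r(2), of x] by auto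
  qed
qed

lemma chronological_U: "chronological U"
  by (rule chronologicalI) (use u_inv_run u_inv_le in fastforce)

section \<open>Simulation of chronological machines\<close>

lemma run_U_unary:
  "run U (n + 2) (0, replicate n True @ False # p, a, []) = (u_start n, p, a, [])"
proof -
  have "run U n (pr 1 (pr 1 m), replicate n True @ p', a, []) = (pr 1 (pr 1 (m + n)), p', a, [])" for m p'
    by (induction n arbitrary: m) (simp_all add: run_Suc_left u_next_def instr_decode_def del: One_nat_def)
  from this[of 0 "False # p"]
  have "run U (1 + n) (pr 0 (pr 0 0), replicate n True @ False # p, a, []) =
      (pr 1 (pr 1 n), False # p, a, [])"
    by (simp only: run_add) (simp add: run_Suc u_next_def instr_decode_def)
  then have "run U (1 + n + 1) (pr 0 (pr 0 0), replicate n True @ False # p, a, []) =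
      (u_start n, p, a, [])"
    by (simp only: run_add) (simp add: run_Suc u_next_def instr_decode_def)
  then show ?thesis by (simp add: pr_0_0 add.commute)
qed

lemma run_U_eval:
  assumes "ph = 9 \<or> ph = 11" "ev_reach e (Rt v 0)"
  shows "\<exists>m. run U m (pr 0 (pr ph (pr b e)), p, a, u) = (pr 0 (pr ph (pr b (Rt v 0))), p, a, u)"
proof -
  obtain n where "(ev_step ^^ n) e = Rt v 0"
    using assms(2) unfolding ev_reach_def by blast
  then show ?thesis
  proof (induction n arbitrary: e)
    case 0
    then show ?case by (intro exI[of _ 0]) simp
  next
    case (Suc n)
    show ?case
    proof (cases "ev_final e")
      \<comment> \<open>\<open>U\<close> stops stepping at a final state, possibly before
        \<open>n\<close> steps are used up; a fixed point must already be the target.\<close>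
      case True
      then have "e = Rt v 0" using ev_steps_final[OF True, of "Suc n"] Suc.prems by simp
      then show ?thesis by (intro exI[of _ 0]) simp
    next
      case False
      have "(ev_step ^^ n) (ev_step e) = Rt v 0"
        using Suc.prems by (simp add: funpow_swap1)
      from Suc.IH[OF this] obtain m where
        "run U m (pr 0 (pr ph (pr b (ev_step e))), p, a, u) = (pr 0 (pr ph (pr b (Rt v 0))), p, a, u)"
        by blast
      then have "run U (Suc m) (pr 0 (pr ph (pr b e)), p, a, u) = (pr 0 (pr ph (pr b (Rt v 0))), p, a, u)"
        using False assms(1) by (auto simp: run_Suc_left u_next_def instr_decode_def)
      then show ?thesis ..
    qed
  qed
qed

lemma run_U_instr:
  assumes "ev_reach (Ev (pfst c) s 0) (Rt i 0)"
  shows "\<exists>m. run U (Suc m) (u_fetch c k s, p, a, u) = (u_exec i c k s, p, a, u)"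
proof -
  obtain m where "run U m (u_fetch c k s, p, a, u) = (pr 0 (pr 9 (pr (pr c (pr k s)) (Rt i 0))), p, a, u)"
    using run_U_eval[OF disjI1[OF refl] assms, of "pr c (pr k s)" p a u] unfolding u_fetch_def by blast
  then have "run U (Suc m) (u_fetch c k s, p, a, u) = (u_exec i c k s, p, a, u)"
    by (simp add: run_Suc u_next_def instr_decode_def ev_final_Rt del: One_nat_def)
  then show ?thesis ..
qed

lemma run_U_next:
  assumes "ev_reach (Ev (psnd c) (pr s x) 0) (Rt s' 0)"
  shows "\<exists>m. run U m (pr 0 (pr 11 (pr (pr c (pr k s)) (Ev (psnd c) (pr s x) 0))), p, a, u)
    = (u_fetch c k s', p, a, u)"
proof -
  obtain m where "run U m (pr 0 (pr 11 (pr (pr c (pr k s)) (Ev (psnd c) (pr s x) 0))), p, a, u)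
    = (pr 0 (pr 11 (pr (pr c (pr k s)) (Rt s' 0))), p, a, u)"
    using run_U_eval[OF disjI2[OF refl] assms] by blast
  then have "run U (Suc m) (pr 0 (pr 11 (pr (pr c (pr k s)) (Ev (psnd c) (pr s x) 0))), p, a, u)
    = (u_fetch c k s', p, a, u)"
    by (simp add: run_Suc u_next_def instr_decode_def ev_final_Rt del: One_nat_def)
  then show ?thesis ..
qed

text \<open>At the start of each round \<open>U\<close> has the tapes and the output of
  \<open>T\<close> itself, and the state \<open>u_fetch c k s\<close> with \<open>k\<close> equal to
  the credit.\<close>

lemma U_simulates:
  assumes T: "chronological_monotone_machine T"
  shows "\<exists>q. \<forall>p a. machine_output U (q @ p) a = machine_output T p a"
proof -
  have rec: "recursive (\<lambda>s. instr_encode (instr_at T s))" "recursive (\<lambda>n. next_state T (pfst n) (psnd n))"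
    and chron: "chronological T"
    using T by (auto simp: chronological_monotone_machine_def effective_def recursive2_def case_prod_beta)
  obtain ci where ci: "\<And>s K. ev_reach (Ev ci s K) (Rt (instr_encode (instr_at T s)) K)"
    using recursive_computes[OF rec(1)] by blast
  obtain cn where "\<And>n K. ev_reach (Ev cn n K) (Rt (next_state T (pfst n) (psnd n)) K)"
    using recursive_computes[OF rec(2)] by blast
  from this[of "pr _ _"] have cn: "ev_reach (Ev cn (pr s x) K) (Rt (next_state T s x) K)" for s x K
    by simp
  define c where "c = pr ci cn"
  have c: "pfst c = ci" "psnd c = cn" by (simp_all add: c_def)
  define q where "q = replicate (c + 4) True @ [False]"
  have "machine_output U (q @ p) a = machine_output T p a" for p a
  proof (rule machine_output_simulation[where c\<^sub>0 = "(u_fetch c 1 0, p, a, [])" and n\<^sub>0 = "c + 4 + 2"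
        and M = "\<lambda>x y. \<exists>s p' a' u k j. y = (s, p', a', u) \<and> x = (u_fetch c k s, p', a', u) \<and>
          run T j (0, p, a, []) = y \<and> k + length a = Suc (length a' + length u)"])
    show "run U (c + 4 + 2) (0, q @ p, a, []) = (u_fetch c 1 0, p, a, [])"
      using run_U_unary[of "c + 4" p a] by (simp add: q_def u_start_def)
    show "\<exists>s p' a' u k j. (0, p, a, []) = (s, p', a', u) \<and>
       (u_fetch c 1 0, p, a, []) = (u_fetch c k s, p', a', u) \<and>
       run T j (0, p, a, []) = (0, p, a, []) \<and> k + length a = Suc (length a' + length u)"
      by (intro exI conjI refl) (auto intro: run_0)
  next
    fix x y
    assume M: "\<exists>s p' a' u k j. y = (s, p', a', u) \<and> x = (u_fetch c k s, p', a', u) \<and>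
          run T j (0, p, a, []) = y \<and> k + length a = Suc (length a' + length u)"
    then show "out x = out y" by auto
    from M obtain s p' a' u k j where y: "y = (s, p', a', u)" and x: "x = (u_fetch c k s, p', a', u)"
      and j: "run T j (0, p, a, []) = (s, p', a', u)" and k: "k + length a = Suc (length a' + length u)"
      by auto
    let ?M = "\<lambda>x y. \<exists>s p' a' u k j. y = (s, p', a', u) \<and> x = (u_fetch c k s, p', a', u) \<and>
          run T j (0, p, a, []) = y \<and> k + length a = Suc (length a' + length u)"
    let ?i = "instr_encode (instr_at T s)"
    obtain m where m: "run U (Suc m) x = (u_exec ?i c k s, p', a', u)"
      using run_U_instr[of c s ?i k p' a' u] ci by (auto simp: c x)
    have cont: "\<exists>m>0. ?M (run U m x) (step T y)"
      if "step U (u_exec ?i c k s, p', a', u) =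
          (pr 0 (pr 11 (pr (pr c (pr k' s)) (Ev cn (pr s z) 0))), p'', a'', u')"
        "step T y = (next_state T s z, p'', a'', u')"
        "k' + length a = Suc (length a'' + length u')" for k' z p'' a'' u'
    proof -
      obtain m' where m': "run U m' (pr 0 (pr 11 (pr (pr c (pr k' s)) (Ev cn (pr s z) 0))), p'', a'', u')
          = (u_fetch c k' (next_state T s z), p'', a'', u')"
        using run_U_next[of c s z "next_state T s z" k' p'' a'' u'] cn by (auto simp: c)
      \<comment> \<open>One round: obtain the instruction, execute it on the actual tapes, obtain
        the next state.\<close>
      have "run U (Suc m + 1 + m') x = (u_fetch c k' (next_state T s z), p'', a'', u')"
        by (simp only: run_add m) (simp add: run_Suc that(1) m' del: step.simps)
      moreover have "run T (Suc j) (0, p, a, []) = step T y"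
        by (simp add: run_Suc j y del: step.simps)
      ultimately have "?M (run U (Suc m + 1 + m') x) (step T y)"
        unfolding that(2) using that(3) by blast
      then show ?thesis by blast
    qed
    have stuck: "\<exists>m>0. halted U (run U m x) \<and> halted T y \<and> out (run U m x) = out y"
      if "step U (u_exec ?i c k s, p', a', u) = (u_exec ?i c k s, p', a', u)" "halted T y"
      using that m halted_fixpoint[of U] by (intro exI[of _ "Suc m"]) (simp add: y del: step.simps)
    show "\<exists>m>0. ?M (run U m x) (step T y) \<or> halted U (run U m x) \<and> halted T y \<and> out (run U m x) = out y"
    proof (cases "instr_at T s")
      case Compute
      have "\<exists>m>0. ?M (run U m x) (step T y)"
        by (rule cont[where z = 0 and k' = k])
           (use Compute k in \<open>simp_all add: y c u_exec_def u_next_def instr_decode_def\<close>)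
      then show ?thesis by blast
    next
      case Read_Program
      show ?thesis
      proof (cases p')
        case Nil
        have "step T y = y" using Nil Read_Program by (simp add: y)
        then show ?thesis using stuck halted_fixpoint Nil Read_Program
          by (auto simp: u_exec_def instr_decode_def)
      next
        case (Cons b p'')
        have "\<exists>m>0. ?M (run U m x) (step T y)"
          by (rule cont[where z = "of_bool b" and k' = k])
             (use Read_Program k Cons in \<open>simp_all add: y c u_exec_def u_next_def instr_decode_def\<close>)
        then show ?thesis by blast
      qed
    next
      case Read_Action
      show ?thesis
      proof (cases "k = 0")
        case True
        \<comment> \<open>With no credit, the actions read exceed the percepts written by one. A
          chronological \<open>T\<close> about to read another action is then silent forever, so
          \<open>dead\<close> has the same output.\<close>
        have "halted T y"
          unfolding y using chronological_halted[OF chron j Read_Action] k True by simp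
        then show ?thesis using stuck True Read_Action
          by (auto simp: u_exec_def u_next_def instr_decode_def dead_def)
      next
        case False
        show ?thesis
        proof (cases a')
          case Nil
          have "step T y = y" using Nil Read_Action by (simp add: y)
          then show ?thesis using stuck halted_fixpoint Nil Read_Action False
            by (auto simp: u_exec_def instr_decode_def)
        next
          case (Cons b a'')
          have "\<exists>m>0. ?M (run U m x) (step T y)"
            by (rule cont[where z = "action_encode b" and k' = "k - 1"])
               (use Read_Action k Cons False in \<open>simp_all add: y c u_exec_def u_next_def instr_decode_def\<close>)
          then show ?thesis by blast
        qed
      qed
    next
      case (Write e)
      have exec: "u_exec ?i c k s = pr ?i (pr 10 (pr c (pr (Suc k) s)))"
        using Write by (cases e) (auto simp: u_exec_def)
      have "\<exists>m>0. ?M (run U m x) (step T y)"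
      proof (rule cont[where z = 0 and k' = "Suc k" and p'' = p' and a'' = a' and u' = "u @ [e]"])
        show "step U (u_exec ?i c k s, p', a', u) =
            (pr 0 (pr 11 (pr (pr c (pr (Suc k) s)) (Ev cn (pr s 0) 0))), p', a', u @ [e])"
          unfolding exec step.simps U_simps instr_decode_encode
          by (simp add: Write c u_next_def)
      qed (use Write k y in auto)
      then show ?thesis by blast
    qed
  qed
  then show ?thesis by blast
qed

theorem universal_U: "universal U"
  by (simp add: universal_def chronological_monotone_machine_def effective_U chronological_U U_simulates)

section \<open>Kraft's inequality and bounds on values\<close>

definition prefix_free :: "'a list set \<Rightarrow> bool" where
  "prefix_free P \<longleftrightarrow> (\<forall>p\<in>P. \<forall>q\<in>P. prefix p q \<longrightarrow> p = q)"

definition weight :: "bool list set \<Rightarrow> real" where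
  "weight P = (\<Sum>\<^sub>\<infinity>p\<in>P. (1/2) ^ length p)"

lemma prefix_free_subset: "prefix_free P \<Longrightarrow> Q \<subseteq> P \<Longrightarrow> prefix_free Q"
  by (auto simp: prefix_free_def)

lemma prefix_free_append_vimage: "prefix_free P \<Longrightarrow> prefix_free {p. q @ p \<in> P}"
  unfolding prefix_free_def by (metis mem_Collect_eq same_append_eq same_prefix_prefix)

text \<open>Splitting by the first bit gives two prefix-free sets of shorter words, each entering
  with factor one half.\<close>

lemma kraft:
  fixes P :: "bool list set"
  assumes "finite P" "prefix_free P"
  shows "(\<Sum>p\<in>P. (1/2) ^ length p) \<le> (1 :: real)"
proof -
  have bounded: "(\<Sum>p\<in>P. (1/2) ^ length p) \<le> (1 :: real)"
    if "finite P" "prefix_free P" "\<forall>p\<in>P. length p \<le> n" for n and P :: "bool list set"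
    using that
  proof (induction n arbitrary: P)
    case 0
    then have "P \<subseteq> {[]}" by auto
    then have "P = {} \<or> P = {[]}" by blast
    then show ?case by auto
  next
    case (Suc n)
    show ?case
    proof (cases "[] \<in> P")
      case True
      then have "p = []" if "p \<in> P" for p
        using Suc.prems(2) that unfolding prefix_free_def by (metis Nil_prefix)
      with True have "P = {[]}" by blast
      then show ?thesis by simp
    next
      case False
      let ?T = "\<lambda>b. {p. b # p \<in> P}"
      have fin: "finite (?T b)" for b
        using finite_vimageI[OF Suc.prems(1), of "Cons b"] by (simp add: vimage_def)
      have "prefix_free (?T b)" for b
        using prefix_free_append_vimage[OF Suc.prems(2), of "[b]"] by simp
      then have IH: "(\<Sum>p\<in>?T b. (1/2) ^ length p) \<le> (1 :: real)" for b
        using Suc.IH[OF fin] Suc.prems(3) by fastforce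
      have "P = Cons True ` ?T True \<union> Cons False ` ?T False"
      proof (intro set_eqI iffI)
        fix p assume "p \<in> P"
        with False show "p \<in> Cons True ` ?T True \<union> Cons False ` ?T False"
          by (cases p; cases "hd p") auto
      qed auto
      then have "(\<Sum>p\<in>P. (1/2) ^ length p) =
          (\<Sum>p\<in>Cons True ` ?T True \<union> Cons False ` ?T False. (1/2) ^ length p :: real)"
        by simp
      also have "\<dots> = (\<Sum>p\<in>Cons True ` ?T True. (1/2) ^ length p) + (\<Sum>p\<in>Cons False ` ?T False. (1/2) ^ length p)"
        by (intro sum.union_disjoint) (auto simp: fin)
      also have "\<dots> = (1/2) * (\<Sum>p\<in>?T True. (1/2) ^ length p) + (1/2) * (\<Sum>p\<in>?T False. (1/2) ^ length p)"
        by (simp add: sum.reindex sum_distrib_left)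
      also have "\<dots> \<le> 1" using IH[of True] IH[of False] by linarith
      finally show ?thesis .
    qed
  qed
  show ?thesis
    using assms(1) by (intro bounded[OF assms, of "Max (length ` P)"]) simp
qed

lemma kraft_prefix:
  fixes P :: "bool list set"
  assumes "finite P" "prefix_free P" "\<forall>p\<in>P. prefix q p"
  shows "(\<Sum>p\<in>P. (1/2) ^ length p) \<le> (1/2 :: real) ^ length q"
proof -
  let ?T = "{p. q @ p \<in> P}"
  have fin: "finite ?T"
    using finite_vimageI[OF assms(1), of "(@) q"] by (simp add: vimage_def inj_on_def)
  have "P = (@) q ` ?T" using assms(3) by (auto elim!: prefixE)
  then have "(\<Sum>p\<in>P. (1/2) ^ length p) = (\<Sum>p\<in>(@) q ` ?T. (1/2) ^ length p :: real)" by simp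
  also have "\<dots> = (1/2) ^ length q * (\<Sum>p\<in>?T. (1/2) ^ length p)"
    by (simp add: sum.reindex inj_on_def sum_distrib_left power_add)
  also have "\<dots> \<le> (1/2) ^ length q * 1"
    by (intro mult_left_mono kraft fin prefix_free_append_vimage assms) simp
  finally show ?thesis by simp
qed

text \<open>\<open>S\<close> need not be prefix-free: each word of \<open>P\<close> is charged to
  one of its prefixes in \<open>S\<close>.\<close>

lemma kraft_prefixes:
  fixes P :: "bool list set"
  assumes "finite S" "finite P" "prefix_free P" "\<forall>p\<in>P. \<exists>q\<in>S. prefix q p"
  shows "(\<Sum>p\<in>P. (1/2) ^ length p) \<le> (\<Sum>q\<in>S. (1/2 :: real) ^ length q)"
  using assms
proof (induction S arbitrary: P rule: finite_induct)
  case (insert q S)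
  let ?P = "{p \<in> P. prefix q p}" and ?Q = "{p \<in> P. \<not> prefix q p}"
  have "(\<Sum>p\<in>P. (1/2) ^ length p) = (\<Sum>p\<in>?P \<union> ?Q. (1/2) ^ length p :: real)"
    by (rule sum.cong) auto
  also have "\<dots> = (\<Sum>p\<in>?P. (1/2) ^ length p) + (\<Sum>p\<in>?Q. (1/2) ^ length p)"
    using insert.prems by (intro sum.union_disjoint) auto
  also have "(\<Sum>p\<in>?P. (1/2) ^ length p) \<le> (1/2 :: real) ^ length q"
    using insert.prems by (intro kraft_prefix) (auto elim: prefix_free_subset)
  also have "(\<Sum>p\<in>?Q. (1/2) ^ length p) \<le> (\<Sum>q\<in>S. (1/2 :: real) ^ length q)"
    using insert.prems by (intro insert.IH) (auto elim: prefix_free_subset)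
  finally show ?case using insert.hyps by simp
qed auto

lemma weight_summable:
  fixes P :: "bool list set"
  shows "prefix_free P \<Longrightarrow> (\<lambda>p. (1/2 :: real) ^ length p) summable_on P"
proof (rule nonneg_bdd_above_summable_on)
  assume "prefix_free P"
  then show "bdd_above (sum (\<lambda>p. (1/2 :: real) ^ length p) ` {F. F \<subseteq> P \<and> finite F})"
    by (intro bdd_aboveI2[where M = 1] kraft[OF _ prefix_free_subset[of P]]) auto
qed simp

lemma weight_le:
  assumes "prefix_free P" "finite S" "\<And>p. p \<in> P \<Longrightarrow> \<exists>q\<in>S. prefix q p"
  shows "weight P \<le> (\<Sum>q\<in>S. (1/2) ^ length q)"
  unfolding weight_def
proof (rule infsum_le_finite_sums[OF weight_summable[OF assms(1)]])
  fix F assume "finite F" "F \<subseteq> P"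
  then show "(\<Sum>p\<in>F. (1/2) ^ length p) \<le> (\<Sum>q\<in>S. (1/2 :: real) ^ length q)"
    using assms by (intro kraft_prefixes) (auto elim: prefix_free_subset)
qed

lemma weight_ge: "prefix_free P \<Longrightarrow> p \<in> P \<Longrightarrow> (1/2) ^ length p \<le> weight P"
  unfolding weight_def
  using finite_sum_le_infsum[OF weight_summable, of P "{p}"] by simp

lemma weight_nonneg: "0 \<le> weight P"
  unfolding weight_def by (rule infsum_nonneg) simp

lemma weight_UN:
  assumes "finite I" "prefix_free (\<Union>i\<in>I. P i)" "\<And>i j. i \<in> I \<Longrightarrow> j \<in> I \<Longrightarrow> i \<noteq> j \<Longrightarrow> P i \<inter> P j = {}"
  shows "weight (\<Union>i\<in>I. P i) = (\<Sum>i\<in>I. weight (P i))"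
  using assms
proof (induction I rule: finite_induct)
  case empty
  then show ?case by (simp add: weight_def)
next
  case (insert i I)
  have "weight (P i \<union> (\<Union>i\<in>I. P i)) = weight (P i) + weight (\<Union>i\<in>I. P i)"
    unfolding weight_def
  proof (rule infsum_Un_disjoint)
    show "P i \<inter> (\<Union>i\<in>I. P i) = {}" using insert by fast
  qed (use insert.prems(1) in \<open>auto intro!: weight_summable elim: prefix_free_subset\<close>)
  also have "weight (\<Union>i\<in>I. P i) = (\<Sum>i\<in>I. weight (P i))"
    using insert by (intro insert.IH) (auto elim: prefix_free_subset)
  finally show ?case using insert.hyps by simp
qed

lemma mixture_weight: "mixture M e a = weight (minimal_programs M e a)"
  by (simp add: mixture_def weight_def)

lemma minimal_programs_output: "p \<in> minimal_programs M e a \<Longrightarrow> e \<in> machine_output M p a"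
  by (simp add: minimal_programs_def)

lemma prefix_free_minimal_programs: "prefix_free (minimal_programs M e a)"
  by (auto simp: prefix_free_def minimal_programs_def strict_prefix_def)

section \<open>Expected rewards as weights of prefix-free sets\<close>

lemma extend_append: "extend \<pi> h (xs @ ys) = extend \<pi> (extend \<pi> h xs) ys"
  by (induction xs arbitrary: h) auto

lemma prefix_extend: "prefix h (extend \<pi> h es)"
proof (induction es arbitrary: h)
  case (Cons e es)
  then show ?case using prefix_order.trans[of h "h @ [(\<pi> h, e)]"] by fastforce
qed simp

lemma map_snd_extend: "map snd (extend \<pi> h es) = map snd h @ es"
  by (induction es arbitrary: h) auto

lemma map_fst_extend_Cons: "\<exists>a. map fst (extend \<pi> h (e # es)) = map fst h @ \<pi> h # a"
  using prefix_extend[of "h @ [(\<pi> h, e)]" \<pi> es] by (auto elim!: prefixE)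

definition ext_programs :: "machine \<Rightarrow> policy \<Rightarrow> history \<Rightarrow> percept list \<Rightarrow> bool list set" where
  "ext_programs M \<pi> h es =
    minimal_programs M (map snd (extend \<pi> h es)) (map fst (extend \<pi> h es))"

lemma on_history_extend: "on_history (mixture M) (extend \<pi> h es) = weight (ext_programs M \<pi> h es)"
  by (simp add: on_history_def mixture_weight ext_programs_def)

text \<open>
  Two continuations share the history up to their first difference, and by chronology the percept
  written there depends only on that history and one more action.
\<close>

lemma ext_programs_incomparable:
  assumes "chronological M" "length es = length es'"
    and p: "p \<in> ext_programs M \<pi> h es" "p' \<in> ext_programs M \<pi> h es'" "prefix p p'"
  shows "es = es'"
proof (rule ccontr)
  assume "es \<noteq> es'"
  from same_length_different[OF this assms(2)]
  obtain cs x xs y ys where xy: "x \<noteq> y" "es = cs @ x # xs" "es' = cs @ y # ys"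
    by (metis append_Cons append_Nil)
  define g where "g = extend \<pi> h cs"
  let ?a = "map fst g @ [\<pi> g]"
  have out: "map snd g @ [z] \<in> machine_output M r ?a"
    if r: "r \<in> ext_programs M \<pi> h (cs @ z # zs)" for r z zs
  proof -
    let ?h = "extend \<pi> h (cs @ z # zs)"
    obtain b where b: "map fst ?h = ?a @ b"
      using map_fst_extend_Cons[of \<pi> g z zs] by (auto simp: extend_append g_def)
    have "map snd ?h = (map snd g @ [z]) @ zs"
      by (simp add: g_def map_snd_extend)
    then have "map snd g @ [z] \<in> machine_output M r (map fst ?h)"
      using r minimal_programs_output machine_output_prefix unfolding ext_programs_def
      by (metis prefixI)
    then show ?thesis
      using assms(1)[unfolded chronological_def, rule_format, of "Suc (length g)" "map fst ?h"
          "map snd g @ [z]" r]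
      by (simp add: b)
  qed
  have "map snd g @ [x] \<in> machine_output M p' ?a"
    using out[of p x xs] p(1,3) xy machine_output_prefix_program by blast
  moreover have "map snd g @ [y] \<in> machine_output M p' ?a"
    using out p(2) xy by blast
  ultimately show False
    using machine_output_comparable xy(1) by fastforce
qed

text \<open>Minimal programs of different continuations are incomparable, so the rewarded
  continuations together form one prefix-free set, to which Kraft's inequality applies as a
  whole.\<close>

lemma expected_reward_eq:
  assumes "chronological M"
  shows "(\<Sum>es | length es = Suc j. reward (last es) *
      (on_history (mixture M) (extend \<pi> h es) / on_history (mixture M) h)) =
    weight (\<Union>es\<in>{es. length es = Suc j \<and> snd (last es)}. ext_programs M \<pi> h es) /
      on_history (mixture M) h"
    and "prefix_free (\<Union>es\<in>{es. length es = Suc j \<and> snd (last es)}. ext_programs M \<pi> h es)"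
proof -
  let ?I = "{es :: percept list. length es = Suc j \<and> snd (last es)}"
  have "finite {es :: percept list. length es = Suc j}"
    using finite_lists_length_eq[of "UNIV :: percept set" "Suc j"] by simp
  then have fin: "finite {es :: percept list. length es = Suc j}" "finite ?I"
    by (auto elim: rev_finite_subset)
  show pf: "prefix_free (\<Union>es\<in>?I. ext_programs M \<pi> h es)"
    unfolding prefix_free_def
  proof (intro ballI impI)
    fix p q assume "p \<in> (\<Union>es\<in>?I. ext_programs M \<pi> h es)" "q \<in> (\<Union>es\<in>?I. ext_programs M \<pi> h es)"
      and "prefix p q"
    then obtain es es' where "es \<in> ?I" "es' \<in> ?I" "p \<in> ext_programs M \<pi> h es" "q \<in> ext_programs M \<pi> h es'"
      by blast
    moreover from this \<open>prefix p q\<close> have "es = es'"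
      by (intro ext_programs_incomparable[OF assms]) auto
    ultimately show "p = q"
      using prefix_free_minimal_programs \<open>prefix p q\<close> unfolding prefix_free_def ext_programs_def by blast
  qed
  have disj: "ext_programs M \<pi> h es \<inter> ext_programs M \<pi> h es' = {}"
    if "es \<in> ?I" "es' \<in> ?I" "es \<noteq> es'" for es es'
    using ext_programs_incomparable[OF assms, of es es' _ \<pi> h _] that by fastforce
  have "(\<Sum>es | length es = Suc j. reward (last es) *
      (on_history (mixture M) (extend \<pi> h es) / on_history (mixture M) h)) =
    (\<Sum>es\<in>?I. weight (ext_programs M \<pi> h es) / on_history (mixture M) h)"
    using fin(1) by (intro sum.mono_neutral_cong_right) (auto simp: reward_def on_history_extend)
  also have "\<dots> = weight (\<Union>es\<in>?I. ext_programs M \<pi> h es) / on_history (mixture M) h"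
    by (subst weight_UN[OF fin(2) pf disj]) (simp_all add: sum_divide_distrib)
  finally show "(\<Sum>es | length es = Suc j. reward (last es) *
      (on_history (mixture M) (extend \<pi> h es) / on_history (mixture M) h)) = \<dots>" .
qed

text \<open>The factors \<open>\<gamma> (t + j) / discount_tail \<gamma> t\<close> sum to one, so
  the value is an average of the expected rewards and inherits their uniform bounds.\<close>

lemma policy_value_bounds:
  assumes "discount_function \<gamma>" "0 \<le> lo"
    and bnd: "\<And>j. lo \<le> (\<Sum>es | length es = Suc j. reward (last es) * (on_history \<nu> (extend \<pi> h es) / on_history \<nu> h))"
      "\<And>j. (\<Sum>es | length es = Suc j. reward (last es) * (on_history \<nu> (extend \<pi> h es) / on_history \<nu> h)) \<le> hi"
  shows "lo \<le> policy_value \<gamma> \<nu> \<pi> h" "policy_value \<gamma> \<nu> \<pi> h \<le> hi"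
proof -
  define t where "t = Suc (length h)"
  define r where "r j = (\<Sum>es | length es = Suc j. reward (last es) * (on_history \<nu> (extend \<pi> h es) / on_history \<nu> h))" for j
  have r: "lo \<le> r j" "r j \<le> hi" for j using bnd by (auto simp: r_def)
  have nonneg: "0 \<le> \<gamma> k" for k
    using assms(1) by (auto simp: discount_function_def)
  have pos: "discount_tail \<gamma> t > 0"
    using assms(1) by (auto simp: discount_function_def)
  have "summable \<gamma>" using assms(1) by (simp add: discount_function_def)
  then have sum: "summable (\<lambda>j. \<gamma> (t + j))"
    using summable_ignore_initial_segment[of \<gamma> t] by (simp add: add.commute)
  have sum_r: "summable (\<lambda>j. \<gamma> (t + j) * r j)"
  proof (rule summable_comparison_test'[OF summable_mult2[OF sum, of hi], of 0])
    show "norm (\<gamma> (t + n) * r n) \<le> \<gamma> (t + n) * hi" for n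
      using nonneg[of "t + n"] r[of n] \<open>0 \<le> lo\<close> by (simp add: mult_left_mono)
  qed
  have V: "policy_value \<gamma> \<nu> \<pi> h = (\<Sum>j. \<gamma> (t + j) * r j) / discount_tail \<gamma> t"
    by (simp add: policy_value_def Let_def t_def r_def)
  have "(\<Sum>j. \<gamma> (t + j) * lo) \<le> (\<Sum>j. \<gamma> (t + j) * r j)"
    using nonneg r sum_r sum by (intro suminf_le summable_mult2 mult_left_mono) auto
  then have "discount_tail \<gamma> t * lo \<le> (\<Sum>j. \<gamma> (t + j) * r j)"
    using suminf_mult2[OF sum, of lo] by (simp add: discount_tail_def)
  then show "lo \<le> policy_value \<gamma> \<nu> \<pi> h"
    unfolding V using pos by (simp add: field_simps)
  have "(\<Sum>j. \<gamma> (t + j) * r j) \<le> (\<Sum>j. \<gamma> (t + j) * hi)"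
    using nonneg r sum_r sum by (intro suminf_le summable_mult2 mult_left_mono) auto
  then have "(\<Sum>j. \<gamma> (t + j) * r j) \<le> discount_tail \<gamma> t * hi"
    using suminf_mult2[OF sum, of hi] by (simp add: discount_tail_def)
  then show "policy_value \<gamma> \<nu> \<pi> h \<le> hi"
    unfolding V using pos by (simp add: field_simps)
qed

lemma policy_value_upper:
  assumes "discount_function \<gamma>" "chronological M" "finite S"
    and xi: "0 < z" "z \<le> on_history (mixture M) h"
    and S: "\<And>es p. es \<noteq> [] \<Longrightarrow> p \<in> ext_programs M \<pi> h es \<Longrightarrow> \<exists>q\<in>S. prefix q p"
  shows "policy_value \<gamma> (mixture M) \<pi> h \<le> (\<Sum>q\<in>S. (1/2) ^ length q) / z"
proof (rule policy_value_bounds(2)[OF assms(1) order_refl])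
  fix j
  let ?P = "\<Union>es\<in>{es. length es = Suc j \<and> snd (last es)}. ext_programs M \<pi> h es"
  have "\<exists>q\<in>S. prefix q p" if "p \<in> ?P" for p
  proof -
    from that obtain es where "length es = Suc j" "p \<in> ext_programs M \<pi> h es" by blast
    then show ?thesis using S[of es p] by (cases es) auto
  qed
  then have "weight ?P \<le> (\<Sum>q\<in>S. (1/2) ^ length q)"
    by (rule weight_le[OF expected_reward_eq(2)[OF assms(2)] assms(3)])
  then have "weight ?P / on_history (mixture M) h \<le> (\<Sum>q\<in>S. (1/2) ^ length q) / z"
    using xi by (intro frac_le sum_nonneg) auto
  then show "(\<Sum>es | length es = Suc j. reward (last es) *
      (on_history (mixture M) (extend \<pi> h es) / on_history (mixture M) h)) \<le> (\<Sum>q\<in>S. (1/2) ^ length q) / z"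
    unfolding expected_reward_eq(1)[OF assms(2)] .
  show "0 \<le> (\<Sum>es | length es = Suc j. reward (last es) *
      (on_history (mixture M) (extend \<pi> h es) / on_history (mixture M) h))"
    unfolding expected_reward_eq(1)[OF assms(2)] using xi weight_nonneg[of ?P] by simp
qed

text \<open>A single program that is minimal for every all-reward continuation contributes its full
  weight at every step.\<close>

lemma policy_value_lower:
  assumes "discount_function \<gamma>" "chronological M"
    and xi: "0 < on_history (mixture M) h" "on_history (mixture M) h \<le> z"
    and p: "\<And>j. p \<in> ext_programs M \<pi> h (replicate (Suc j) (False, True))"
  shows "(1/2) ^ length p / z \<le> policy_value \<gamma> (mixture M) \<pi> h"
proof (rule policy_value_bounds(1)[OF assms(1)])
  show "0 \<le> (1/2) ^ length p / z" using xi by simp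
  fix j
  let ?P = "\<Union>es\<in>{es. length es = Suc j \<and> snd (last es)}. ext_programs M \<pi> h es"
  have "length (replicate (Suc j) (False, True)) = Suc j" "snd (last (replicate (Suc j) (False, True)))"
    by (simp_all add: last_replicate del: replicate_Suc)
  with p[of j] have "p \<in> ?P" by blast
  then have "(1/2) ^ length p \<le> weight ?P"
    by (intro weight_ge expected_reward_eq assms)
  then have "(1/2) ^ length p / z \<le> weight ?P / on_history (mixture M) h"
    using xi by (intro frac_le weight_nonneg) auto
  then show "(1/2) ^ length p / z \<le> (\<Sum>es | length es = Suc j. reward (last es) *
      (on_history (mixture M) (extend \<pi> h es) / on_history (mixture M) h))"
    unfolding expected_reward_eq(1)[OF assms(2)] .
  \<comment> \<open>An upper bound is required only for summability in
    \<open>policy_value_bounds\<close>; the empty prefix covers all programs.\<close>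
  have "weight ?P \<le> (\<Sum>q\<in>{[] :: bool list}. (1/2) ^ length q)"
    by (intro weight_le expected_reward_eq assms) auto
  then show "(\<Sum>es | length es = Suc j. reward (last es) *
      (on_history (mixture M) (extend \<pi> h es) / on_history (mixture M) h)) \<le> 1 / on_history (mixture M) h"
    unfolding expected_reward_eq(1)[OF assms(2)] using xi by (simp add: divide_right_mono)
qed

section \<open>Queries\<close>

definition query_actions :: "nat \<Rightarrow> action list" where
  "query_actions s = replicate s Alpha @ [Beta]"

definition query :: "nat \<Rightarrow> history" where
  "query s = map (\<lambda>a. (a, (False, False))) (query_actions s)"

lemma map_fst_query: "map fst (query s) = query_actions s"
  by (simp add: query_def comp_def)

lemma map_snd_query: "map snd (query s) = replicate (Suc s) (False, False)"
  by (simp add: query_def query_actions_def comp_def map_replicate_const replicate_append_same)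

lemma run_U_query:
  "\<exists>n. run U n (0, False # p, query_actions s @ a, []) =
    (pr 2 (pr 5 s), p, a, replicate (Suc s) (False, False))"
proof -
  have count: "run U (2 * n) (pr 2 (pr 2 m), p, replicate n Alpha @ b, u) =
      (pr 2 (pr 2 (m + n)), p, b, u @ replicate n (False, False))" for n m b u
    by (induction n arbitrary: m u) (simp_all add: run_Suc_left u_next_def instr_decode_def)
  have "run U (2 + (2 * s + 2)) (0, False # p, query_actions s @ a, []) =
      run U 2 (run U (2 * s) (run U 2 (0, False # p, query_actions s @ a, [])))"
    by (simp only: run_add)
  also have "run U 2 (0, False # p, query_actions s @ a, []) = (pr 2 (pr 2 0), p, query_actions s @ a, [])"
    using run_U_unary[of 0 p "query_actions s @ a"] by (simp add: u_start_def numeral_2_eq_2)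
  also have "run U (2 * s) (pr 2 (pr 2 0), p, query_actions s @ a, []) =
      (pr 2 (pr 2 s), p, Beta # a, replicate s (False, False))"
    using count[of s 0 "Beta # a" "[]"] by (simp add: query_actions_def)
  also have "run U 2 (pr 2 (pr 2 s), p, Beta # a, replicate s (False, False)) =
      (pr 2 (pr 5 s), p, a, replicate (Suc s) (False, False))"
    by (simp add: run_Suc numeral_2_eq_2 u_next_def instr_decode_def replicate_append_same)
  finally show ?thesis by blast
qed

lemma run_U_rewards:
  "run U n (pr 4 (pr 8 0), p, a, u) = (pr 4 (pr 8 0), p, a, u @ replicate n (False, True))"
  by (induction n arbitrary: u) (simp_all add: run_Suc_left u_next_def instr_decode_def)

lemma machine_output_rewards:
  assumes "run U n (0, p, a, []) = (pr 4 (pr 8 0), p', a', u)"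
  shows "u @ replicate j (False, True) \<in> machine_output U p a"
  unfolding mem_machine_output by (rule exI[of _ "n + j"]) (simp add: run_add assms run_U_rewards)

text \<open>Any other program either ends while its leading ones are being counted, where
  \<open>U\<close> waits, or has one to three ones before a zero, which leads to
  \<open>dead\<close>.\<close>

lemma U_output_nonempty:
  assumes "e \<in> machine_output U p a" "e \<noteq> []"
  shows "prefix [False] p \<or> prefix (replicate 4 True) p"
proof (rule ccontr)
  assume no: "\<not> ?thesis"
  define n where "n = length (takeWhile id p)"
  define r where "r = dropWhile id p"
  have tw: "takeWhile id p = replicate n True"
    unfolding n_def by (rule replicate_length_same[symmetric]) (auto dest: set_takeWhileD)
  have p: "p = replicate n True @ r"
    unfolding tw[symmetric] r_def by simp
  have "n < 4"
  proof (rule ccontr)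
    assume "\<not> n < 4"
    then have "replicate n True = replicate 4 True @ replicate (n - 4) True"
      by (simp flip: replicate_add)
    then show False using no p by simp
  qed
  have "\<exists>m. halted U (run U m (0, p, a, [])) \<and> out (run U m (0, p, a, [])) = []"
  proof (cases r)
    case Nil
    have "run U m (pr 1 (pr 1 k), replicate m True, a, []) = (pr 1 (pr 1 (k + m)), [], a, [])" for m k
      by (induction m arbitrary: k)
         (simp_all add: run_Suc_left u_next_def instr_decode_def del: One_nat_def)
    then have "run U (1 + n) (pr 0 (pr 0 0), p, a, []) = (pr 1 (pr 1 n), [], a, [])"
      unfolding p Nil by (simp only: run_add) (simp add: run_Suc u_next_def instr_decode_def)
    then have "run U (1 + n) (0, p, a, []) = (pr 1 (pr 1 n), [], a, [])"
      by (simp only: pr_0_0)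
    moreover have "halted U (pr 1 (pr 1 n), [], a, [])"
      by (rule halted_fixpoint) (simp add: instr_decode_def)
    ultimately show ?thesis by (metis snd_conv)
  next
    case (Cons b r')
    have "\<not> b" using Cons hd_dropWhile[of id p] unfolding r_def by fastforce
    have "n \<noteq> 0"
      using Cons no p \<open>\<not> b\<close> by (intro notI) auto
    with \<open>n < 4\<close> have "u_start n = dead" by (auto simp: u_start_def)
    then have "run U (n + 2) (0, p, a, []) = (dead, r', a, [])"
      using run_U_unary[of n r' a] p Cons \<open>\<not> b\<close> by simp
    moreover have "halted U (dead, r', a, [])"
      by (rule halted_fixpoint) (simp add: instr_decode_def dead_def u_next_def)
    ultimately show ?thesis by (metis snd_conv)
  qed
  then show False using halted_machine_output[OF _ _ assms(1)] assms(2) by fastforce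
qed

text \<open>After \<open>Alpha\<close> the coin is the second program bit: if it is missing
  \<open>U\<close> waits, and if it is zero \<open>U\<close> enters \<open>dead\<close>.\<close>

lemma U_output_Alpha:
  assumes "e \<in> machine_output U p (query_actions s @ Alpha # a)" "length e > Suc s"
  shows "prefix [False, True] p \<or> prefix (replicate 4 True) p"
proof (rule ccontr)
  assume no: "\<not> ?thesis"
  then obtain p' where p: "p = False # p'"
    using U_output_nonempty[OF assms(1)] assms(2) by (cases e) (auto elim: prefixE)
  obtain n where n: "run U n (0, p, query_actions s @ Alpha # a, []) =
      (pr 2 (pr 5 s), p', Alpha # a, replicate (Suc s) (False, False))"
    using run_U_query p by blast
  let ?c = "run U 2 (run U n (0, p, query_actions s @ Alpha # a, []))"
  have "halted U ?c \<and> out ?c = replicate (Suc s) (False, False)"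
    unfolding n using no p
    by (cases p') (auto simp: run_Suc numeral_2_eq_2 u_next_def instr_decode_def dead_def
        intro!: halted_fixpoint)
  then show False
    using halted_machine_output[OF run_add _ assms(1)] assms(2)
    by (metis length_replicate not_le prefix_length_le)
qed

lemma U_output_Alpha_reward:
  "replicate (Suc s) (False, False) @ replicate j (False, True) \<in>
    machine_output U [False, True] (query_actions s @ Alpha # a)"
proof -
  obtain n where n: "run U n (0, [False, True], query_actions s @ Alpha # a, []) =
      (pr 2 (pr 5 s), [True], Alpha # a, replicate (Suc s) (False, False))"
    using run_U_query by blast
  have "run U (n + 2) (0, [False, True], query_actions s @ Alpha # a, []) =
      (pr 4 (pr 8 0), [], a, replicate (Suc s) (False, False))"
    unfolding run_add n by (simp add: run_Suc numeral_2_eq_2 u_next_def instr_decode_def)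
  then show ?thesis by (rule machine_output_rewards)
qed

lemma run_U_search:
  assumes "\<And>i. i < n \<Longrightarrow> \<not> ev_final ((ev_step ^^ i) s)"
  shows "run U n (pr 0 (pr 7 s), p, a, u) = (pr 0 (pr 7 ((ev_step ^^ n) s)), p, a, u)"
  using assms by (induction n) (simp_all add: run_Suc u_next_def instr_decode_def)

lemma U_output_Beta_halting:
  assumes "s \<in> halting"
  shows "replicate (Suc s) (False, False) @ replicate j (False, True) \<in>
    machine_output U [False] (query_actions s @ Beta # a)"
proof -
  obtain n where n: "run U n (0, [False], query_actions s @ Beta # a, []) =
      (pr 2 (pr 5 s), [], Beta # a, replicate (Suc s) (False, False))"
    using run_U_query by blast
  define m where "m = (LEAST i. ev_final ((ev_step ^^ i) s))"
  have m: "ev_final ((ev_step ^^ m) s)" "\<And>i. i < m \<Longrightarrow> \<not> ev_final ((ev_step ^^ i) s)"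
    using assms unfolding m_def halting_def by (auto intro: LeastI_ex dest: not_less_Least)
  \<comment> \<open>One step reads \<open>Beta\<close>, \<open>m\<close> steps run the computation,
    and one step notices that its state is final.\<close>
  have "run U (n + 1 + m + 1) (0, [False], query_actions s @ Beta # a, []) =
      (pr 4 (pr 8 0), [], a, replicate (Suc s) (False, False))"
    using m(1) unfolding run_add n
    by (simp add: run_Suc u_next_def instr_decode_def run_U_search[OF m(2)])
  then show ?thesis by (rule machine_output_rewards)
qed

lemma U_output_Beta_not_halting:
  assumes "s \<notin> halting" "e \<in> machine_output U p (query_actions s @ Beta # a)" "length e > Suc s"
  shows "prefix (replicate 4 True) p"
proof (rule ccontr)
  assume "\<not> ?thesis"
  then obtain p' where p: "p = False # p'"
    using U_output_nonempty[OF assms(2)] assms(3) by (cases e) (auto elim: prefixE)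
  obtain n where n: "run U n (0, p, query_actions s @ Beta # a, []) =
      (pr 2 (pr 5 s), p', Beta # a, replicate (Suc s) (False, False))"
    using run_U_query p by blast
  let ?c = "(pr 0 (pr 7 s), p', a, replicate (Suc s) (False, False))"
  have "run U (n + 1) (0, p, query_actions s @ Beta # a, []) = ?c"
    unfolding run_add n by (simp add: run_Suc u_next_def instr_decode_def)
  moreover have "halted U ?c"
    using assms(1) by (simp add: halted_def run_U_search halting_def)
  ultimately show False
    using halted_machine_output[OF _ _ assms(2)] assms(3) by (fastforce dest!: prefix_length_le)
qed

text \<open>The upper bound is \<open>1/2 + 1/16\<close>, from the zero bit and the four ones. The
  lower bound is the weight of \<open>[False]\<close>, which suffices because the coin is read only
  after the query.\<close>

lemma mixture_query:
  "1/2 \<le> on_history (mixture U) (query s)" "on_history (mixture U) (query s) \<le> 9/16"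
proof -
  let ?P = "minimal_programs U (replicate (Suc s) (False, False)) (query_actions s)"
  have xi: "on_history (mixture U) (query s) = weight ?P"
    by (simp add: on_history_def map_fst_query map_snd_query mixture_weight)
  have "weight ?P \<le> (\<Sum>q\<in>{[False], replicate 4 True}. (1/2) ^ length q)"
  proof (rule weight_le[OF prefix_free_minimal_programs])
    fix p assume "p \<in> ?P"
    from U_output_nonempty[OF minimal_programs_output[OF this]]
    show "\<exists>q\<in>{[False], replicate 4 True}. prefix q p" by simp
  qed simp
  also have "\<dots> = 9/16" by (simp add: eval_nat_numeral)
  finally show "on_history (mixture U) (query s) \<le> 9/16" unfolding xi .
  obtain n where "run U n (0, [False], query_actions s @ [], []) =
    (pr 2 (pr 5 s), [], [], replicate (Suc s) (False, False))"
    using run_U_query by blast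
  then have "replicate (Suc s) (False, False) \<in> machine_output U [False] (query_actions s)"
    unfolding mem_machine_output by (intro exI[of _ n]) simp
  moreover have "replicate (Suc s) (False, False) \<notin> machine_output U p (query_actions s)"
    if "strict_prefix p [False]" for p
    using U_output_nonempty[of "replicate (Suc s) (False, False)" p "query_actions s"] that by (auto simp: strict_prefix_def prefix_Cons)
  ultimately have "[False] \<in> ?P" by (simp add: minimal_programs_def del: replicate_Suc)
  from weight_ge[OF prefix_free_minimal_programs this]
  show "1/2 \<le> on_history (mixture U) (query s)" unfolding xi by simp
qed

lemma ext_programs_query:
  "\<exists>a. ext_programs U \<pi> (query s) (e # es) =
    minimal_programs U (replicate (Suc s) (False, False) @ e # es) (query_actions s @ \<pi> (query s) # a)"
  using map_fst_extend_Cons[of \<pi> "query s" e es]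
  by (auto simp: ext_programs_def map_snd_extend map_fst_query map_snd_query simp del: replicate_Suc)

section \<open>Values at the query histories\<close>

context
  fixes \<gamma> :: "nat \<Rightarrow> real"
  assumes \<gamma>: "discount_function \<gamma>"
begin

abbreviation value_at_query :: "policy \<Rightarrow> nat \<Rightarrow> real" where
  "value_at_query \<pi> s \<equiv> policy_value \<gamma> (mixture U) \<pi> (query s)"

lemma upper_by_prefixes:
  assumes "finite S"
    and "\<And>a e p. length e > Suc s \<Longrightarrow>
      e \<in> machine_output U p (query_actions s @ \<pi> (query s) # a) \<Longrightarrow> \<exists>q\<in>S. prefix q p"
  shows "value_at_query \<pi> s \<le> (\<Sum>q\<in>S. (1/2) ^ length q) / (1/2)"
proof (rule policy_value_upper[OF \<gamma> chronological_U assms(1) _ mixture_query(1)])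
  fix es p assume "es \<noteq> []" "p \<in> ext_programs U \<pi> (query s) es"
  then obtain a where "p \<in> minimal_programs U (replicate (Suc s) (False, False) @ es)
      (query_actions s @ \<pi> (query s) # a)"
    using ext_programs_query by (cases es) blast+
  then show "\<exists>q\<in>S. prefix q p"
    using \<open>es \<noteq> []\<close> by (intro assms(2)[OF _ minimal_programs_output]) auto
qed simp

text \<open>A crude bound, total weight \<open>1\<close> over \<open>1/2\<close>, which makes the
  supremum in \<open>optimal_value\<close> meaningful.\<close>

lemma value_le_2: "value_at_query \<pi> s \<le> 2"
  using upper_by_prefixes[of "{[]}" s \<pi>] by simp

text \<open>The bound is \<open>(1/4 + 1/16) / (1/2)\<close>: winning coin flips and programs with
  four ones, over the least possible mixture weight.\<close>

lemma value_le_Alpha: "\<pi> (query s) = Alpha \<Longrightarrow> value_at_query \<pi> s \<le> 5/8"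
  using upper_by_prefixes[of "{[False, True], replicate 4 True}" s \<pi>] U_output_Alpha
  by (force simp: eval_nat_numeral)

text \<open>Only programs with four ones can still produce output:
  \<open>(1/16) / (1/2)\<close>.\<close>

lemma value_le_Beta: "\<pi> (query s) = Beta \<Longrightarrow> s \<notin> halting \<Longrightarrow> value_at_query \<pi> s \<le> 1/8"
  using upper_by_prefixes[of "{replicate 4 True}" s \<pi>] U_output_Beta_not_halting
  by (force simp: eval_nat_numeral)

lemma lower_by_program:
  assumes "\<And>a j. replicate (Suc s) (False, False) @ replicate (Suc j) (False, True)
      \<in> machine_output U p (query_actions s @ \<pi> (query s) # a)"
    and "\<And>a e p'. length e > Suc s \<Longrightarrow> strict_prefix p' p \<Longrightarrow>
      e \<notin> machine_output U p' (query_actions s @ \<pi> (query s) # a)"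
  shows "(1/2) ^ length p / (9/16) \<le> value_at_query \<pi> s"
proof (rule policy_value_lower[OF \<gamma> chronological_U _ mixture_query(2)])
  show "0 < on_history (mixture U) (query s)" using mixture_query(1)[of s] by simp
  fix j
  obtain a where "ext_programs U \<pi> (query s) (replicate (Suc j) (False, True)) =
      minimal_programs U (replicate (Suc s) (False, False) @ replicate (Suc j) (False, True))
        (query_actions s @ \<pi> (query s) # a)"
    using ext_programs_query by (metis replicate_Suc)
  then show "p \<in> ext_programs U \<pi> (query s) (replicate (Suc j) (False, True))"
    using assms by (simp add: minimal_programs_def del: replicate_Suc)
qed

text \<open>The program \<open>[False]\<close> alone gives \<open>(1/2) / (9/16)\<close>; it is
  minimal because its only proper prefix, the empty program, outputs nothing.\<close>

lemma value_ge_Beta: "\<pi> (query s) = Beta \<Longrightarrow> s \<in> halting \<Longrightarrow> 8/9 \<le> value_at_query \<pi> s"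
proof -
  assume "\<pi> (query s) = Beta" "s \<in> halting"
  have "e \<notin> machine_output U p (query_actions s @ \<pi> (query s) # a)"
    if "length e > Suc s" "strict_prefix p [False]" for e p a
    using U_output_nonempty[of e p] that by (cases e) (auto simp: strict_prefix_def prefix_Cons)
  then have "(1/2) ^ length [False] / (9/16) \<le> value_at_query \<pi> s"
    using U_output_Beta_halting[OF \<open>s \<in> halting\<close>] \<open>\<pi> (query s) = Beta\<close>
    by (intro lower_by_program) (simp_all del: replicate_Suc)
  then show ?thesis by simp
qed

text \<open>The program \<open>[False, True]\<close> gives \<open>(1/4) / (9/16)\<close>, the
  largest possible mixture weight being the divisor.\<close>

lemma value_ge_Alpha: "\<pi> (query s) = Alpha \<Longrightarrow> 4/9 \<le> value_at_query \<pi> s"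
proof -
  assume A: "\<pi> (query s) = Alpha"
  have "e \<notin> machine_output U p (query_actions s @ Alpha # a)"
    if "length e > Suc s" "strict_prefix p [False, True]" for e p a
  proof
    assume "e \<in> machine_output U p (query_actions s @ Alpha # a)"
    from U_output_Alpha[OF this that(1)] that(2) show False
      by (auto simp: strict_prefix_def prefix_Cons eval_nat_numeral)
  qed
  then have "(1/2) ^ length [False, True] / (9/16) \<le> value_at_query \<pi> s"
    using U_output_Alpha_reward A
    by (intro lower_by_program) (simp_all del: replicate_Suc)
  then show ?thesis by simp
qed

text \<open>The wrong action loses at least \<open>8/9 - 5/8 = 19/72\<close> or
  \<open>4/9 - 1/8 = 23/72\<close>, both above \<open>1/4 = 18/72\<close>. Constant policies are
  competitors enough, since later actions do not affect the lower bounds.\<close>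

lemma eps_optimal_query:
  assumes "eps_optimal \<gamma> (mixture U) (1/4) \<pi>"
  shows "\<pi> (query s) = Beta \<longleftrightarrow> s \<in> halting"
proof -
  have "bdd_above (range (\<lambda>\<pi>. value_at_query \<pi> s))"
    by (intro bdd_aboveI2[where M = 2] value_le_2)
  then have opt: "value_at_query \<pi>' s \<le> optimal_value \<gamma> (mixture U) (query s)" for \<pi>'
    unfolding optimal_value_def by (rule cSUP_upper2) auto
  have less: "value_at_query \<pi>' s - value_at_query \<pi> s < 1/4" for \<pi>'
    using assms opt[of \<pi>'] unfolding eps_optimal_def by (smt (verit))
  show ?thesis
  proof
    assume "\<pi> (query s) = Beta"
    then show "s \<in> halting"
      using less[of "\<lambda>_. Alpha"] value_ge_Alpha[of "\<lambda>_. Alpha" s] value_le_Beta[of \<pi> s] by force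
  next
    assume "s \<in> halting"
    then show "\<pi> (query s) = Beta"
      using less[of "\<lambda>_. Beta"] value_ge_Beta[of "\<lambda>_. Beta" s] value_le_Alpha[of \<pi> s]
      by (cases "\<pi> (query s)") auto
  qed
qed

end

section \<open>Reduction to the policy graph\<close>

lemma mem_policy_graph:
  "prod_encode (history_encode h, action_encode a) \<in> policy_graph \<pi> \<longleftrightarrow> \<pi> h = a"
proof -
  have per: "inj percept_encode"
    by (rule injI) (auto split: if_splits simp: of_bool_def)
  have act: "inj action_encode"
    by (rule injI) (metis action.exhaust action_encode.simps zero_neq_one)
  have "inj (\<lambda>(a, e). prod_encode (action_encode a, percept_encode e))"
    by (rule injI) (simp add: case_prod_beta inj_eq[OF act] inj_eq[OF per] prod_eq_iff)
  then have "inj history_encode"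
    unfolding history_encode_def by (intro injI) (simp only: list_encode_eq inj_map_eq_map)
  with act show ?thesis
    unfolding policy_graph_def by (auto dest: injD)
qed

text \<open>The actions \<open>Alpha\<close> stand in front, so each query arises from the previous
  one by a cons, which \<open>list_encode\<close> turns into \<open>Suc\<close> of a pair.\<close>

lemma recursive_query: "recursive (\<lambda>s. history_encode (query s))"
proof -
  let ?x = "prod_encode (action_encode Alpha, percept_encode (False, False))"
  have "rec_nat (history_encode (query 0)) (\<lambda>_ r. Suc (pr ?x r)) s = history_encode (query s)" for s
    by (induction s) (simp_all add: history_encode_def query_def query_actions_def)
  moreover have "recursive (\<lambda>s. rec_nat (history_encode (query 0)) (\<lambda>_ r. Suc (pr ?x r)) s)"
    by (intro recursive_rec_nat recursive_intros)
  ultimately show ?thesis by simp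
qed

lemma Sigma01_hard_policy_graph:
  assumes "\<And>s. \<pi> (query s) = Beta \<longleftrightarrow> s \<in> halting"
  shows "Sigma01_hard (policy_graph \<pi>)"
  unfolding Sigma01_hard_def many_one_reducible_def
proof (intro allI impI)
  fix A assume "Sigma01 A"
  then obtain c where c: "\<And>n. n \<in> A \<longleftrightarrow> Ev c n 0 \<in> halting"
    using Sigma01_reduces_to_halting by blast
  let ?f = "\<lambda>n. prod_encode (history_encode (query (Ev c n 0)), action_encode Beta)"
  have "recursive ?f"
    by (intro recursive_intros recursive_comp[OF recursive_query])
  moreover have "n \<in> A \<longleftrightarrow> ?f n \<in> policy_graph \<pi>" for n
    unfolding mem_policy_graph c assms ..
  ultimately show "\<exists>f. recursive f \<and> (\<forall>n. n \<in> A \<longleftrightarrow> f n \<in> policy_graph \<pi>)" by blast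
qed

theorem theorem6p17:
  fixes \<gamma> :: "nat \<Rightarrow> real"
  assumes "discount_function \<gamma>"
  shows "\<exists>U' \<epsilon>. universal U' \<and> 0 < \<epsilon> \<and>
    (\<forall>\<pi>. eps_optimal \<gamma> (mixture U') \<epsilon> \<pi> \<longrightarrow> Sigma01_hard (policy_graph \<pi>))"
proof (intro exI conjI allI impI)
  show "universal U" by (rule universal_U)
  show "Sigma01_hard (policy_graph \<pi>)" if "eps_optimal \<gamma> (mixture U) (1/4) \<pi>" for \<pi>
    using eps_optimal_query[OF assms that] by (rule Sigma01_hard_policy_graph)
qed simp

end
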